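(* Let $P$ be a full-dimensional polytope in $\mathbb{P}^n$ with $N$ vertices and a simple hyperplane arrangement $\mathcal{H}_P$. The dimension of $\mathbb{V}_P=\mathrm{span}\{\omega_P(A_P)\}\subset\mathbb{P}(\Omega_P^\ast)$ is $N-n-2$. The projection $\rho_P:\mathbb{P}(\Omega_P^\ast)\dashrightarrow\mathbb{P}^n$ from $\mathbb{V}_P$ restricted to the Wachspress variety $W_P$ is the inverse of the Wachspress map $\omega_P$.
   Context: $\mathbb{P}^n$ is complex projective $n$-space. A full-dimensional polytope $P$ in $\mathbb{P}^n$ is the collection of the Zariski closures in $\mathbb{P}^n$ of the (nonempty) faces of a full-dimensional convex polytope in an affine chart $\mathbb{R}^n\subset\mathbb{P}^n$. $\mathcal{H}_P$ is the arrangement of hyperplanes spanned by the facets of $P$; it is simple if through any point of $\mathbb{P}^n$ pass at most $n$ hyperplanes of $\mathcal{H}_P$. The residual arrangement $\mathcal{R}_P$ is the union of all linear spaces that are intersections of hyperplanes in $\mathcal{H}_P$ and do not contain any face of $P$. Let $d$ be the number of facets of $P$. The adjoint $A_P$ is the unique hypersurface of degree $d-n-1$ in $\mathbb{P}^n$ vanishing along $\mathcal{R}_P$. Let $\Omega_P:=H^0(\mathbb{P}^n,\mathcal{I}_{\mathcal{R}_P}(d-n))$. For each facet $F$ let $\ell_F$ be a homogeneous linear form defining the hyperplane spanned by $F$. The $N$ forms $\prod_{F\not\ni u}\ell_F$ (product over facets $F$ of $P$ not containing $u$), for $u$ a vertex of $P$, form a basis of $\Omega_P$. The Wachspress map $\omega_P:\mathbb{P}^n\dashrightarrow\mathbb{P}(\Omega_P^\ast)\cong\mathbb{P}^{N-1}$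 is the rational map given by these $N$ forms, and the Wachspress variety is $W_P:=\overline{\omega_P(\mathbb{P}^n)}$. $\mathbb{V}_P$ is the projective span of the image of $A_P$ under $\omega_P$ (the empty set has dimension $-1$), and $\rho_P$ is the linear projection from $\mathbb{V}_P$; its target $\mathbb{P}^n$ is identified with the source of $\omega_P$ by suitable coordinates. "Inverse" means inverse as a rational map. *)

theory Defs
  imports "HOL-Analysis.Analysis"
begin

section \<open>Complex projective space and its Zariski topology\<close>

text \<open>A point of the projective space with homogeneous coordinates indexed by \<open>'m\<close> is a
  line through the origin, so \<open>'m proj\<close> has dimension \<open>CARD('m) - 1\<close>.\<close>

typedef (overloaded) 'm proj =
  "{L :: (complex^'m::finite) set. \<exists>v. v \<noteq> 0 \<and> L = range (\<lambda>c. c *s v)}"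
  morphisms line_of proj_of_line
proof -
  have "(\<chi> i. 1 :: complex^'m) \<noteq> 0" by (simp add: vec_eq_iff)
  then show ?thesis by blast
qed

text \<open>The point with homogeneous coordinates \<open>v\<close>; meaningful only for \<open>v \<noteq> 0\<close>.\<close>

definition point :: "complex^'m::finite \<Rightarrow> 'm proj"
  where "point v = proj_of_line (range (\<lambda>c. c *s v))"

lemma line_of_point: "v \<noteq> 0 \<Longrightarrow> line_of (point v) = range (\<lambda>c. c *s v)"
  unfolding point_def by (rule proj_of_line_inverse) blast

lemma point_cases: obtains v where "v \<noteq> 0" "p = point v"
proof -
  obtain v where "v \<noteq> 0" "line_of p = range (\<lambda>c. c *s v)"
    using line_of[of p] by blast
  then show thesis
    using that[of v] by (metis line_of_inverse point_def)
qed

text \<open>Homogeneous polynomials are represented by the functions they induce, which loses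
  nothing over an infinite field; the zero function is homogeneous of every degree.\<close>

definition exponents :: "nat \<Rightarrow> ('m::finite \<Rightarrow> nat) set"
  where "exponents k = {a. (\<Sum>i\<in>UNIV. a i) = k}"

definition homogeneous :: "nat \<Rightarrow> (complex^'m::finite \<Rightarrow> complex) \<Rightarrow> bool"
  where "homogeneous k f \<longleftrightarrow>
    (\<exists>c. f = (\<lambda>x. \<Sum>a\<in>exponents k. c a * (\<Prod>i\<in>UNIV. (x $ i) ^ a i)))"

definition zeros :: "(complex^'m::finite \<Rightarrow> complex) \<Rightarrow> 'm proj set"
  where "zeros f = {p. \<forall>x\<in>line_of p. f x = 0}"

definition zariski :: "'m::finite proj topology"
  where "zariski = topology_generated_by {- zeros f | f. \<exists>k. homogeneous k f}"

lemma finite_exponents: "finite (exponents k :: ('m::finite \<Rightarrow> nat) set)"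
proof (rule finite_subset)
  show "exponents k \<subseteq> (UNIV :: 'm set) \<rightarrow>\<^sub>E {..k}"
    by (auto simp: exponents_def PiE_def intro: member_le_sum)
qed (simp add: finite_PiE)

lemma homogeneous_sum_monomials:
  fixes e :: "'s \<Rightarrow> 'm::finite \<Rightarrow> nat"
  assumes "finite S" and "\<And>s. s \<in> S \<Longrightarrow> e s \<in> exponents k"
  shows "homogeneous k (\<lambda>x. \<Sum>s\<in>S. c s * (\<Prod>i\<in>UNIV. (x $ i) ^ e s i))"
  unfolding homogeneous_def
proof (intro exI ext)
  fix x :: "complex^'m"
  let ?m = "\<lambda>a. \<Prod>i\<in>UNIV. (x $ i) ^ a i"
  have "(\<Sum>s\<in>S. c s * ?m (e s)) = (\<Sum>a\<in>exponents k. \<Sum>s\<in>{s\<in>S. e s = a}. c s * ?m (e s))"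
    using assms by (intro sum.group[symmetric] finite_exponents) auto
  also have "\<dots> = (\<Sum>a\<in>exponents k. (\<Sum>s\<in>{s\<in>S. e s = a}. c s) * ?m a)"
    by (simp add: sum_distrib_right)
  finally show "(\<Sum>s\<in>S. c s * ?m (e s)) = (\<Sum>a\<in>exponents k. (\<Sum>s\<in>{s\<in>S. e s = a}. c s) * ?m a)" .
qed

lemma homogeneous_mult:
  assumes "homogeneous j f" and "homogeneous k g"
  shows "homogeneous (j + k) (\<lambda>x. f x * g x)"
proof -
  obtain c d where f: "f = (\<lambda>x. \<Sum>a\<in>exponents j. c a * (\<Prod>i\<in>UNIV. (x $ i) ^ a i))"
    and g: "g = (\<lambda>x. \<Sum>a\<in>exponents k. d a * (\<Prod>i\<in>UNIV. (x $ i) ^ a i))"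
    using assms unfolding homogeneous_def by blast
  have "homogeneous (j + k) (\<lambda>x. \<Sum>s\<in>exponents j \<times> exponents k.
      (c (fst s) * d (snd s)) * (\<Prod>i\<in>UNIV. (x $ i) ^ (fst s i + snd s i)))"
    by (rule homogeneous_sum_monomials)
      (auto simp: exponents_def sum.distrib intro!: finite_cartesian_product
        finite_exponents[unfolded exponents_def])
  also have "(\<lambda>x. \<Sum>s\<in>exponents j \<times> exponents k.
      (c (fst s) * d (snd s)) * (\<Prod>i\<in>UNIV. (x $ i) ^ (fst s i + snd s i))) = (\<lambda>x. f x * g x)"
    by (simp add: f g sum_product sum.cartesian_product split_beta power_add prod.distrib
        algebra_simps fun_eq_iff)
  finally show ?thesis .
qed

lemma homogeneous_scale:
  assumes "homogeneous k f"
  shows "f (t *s x) = t ^ k * f x"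
proof -
  have "(\<Prod>i\<in>UNIV. (t * x $ i) ^ a i) = t ^ k * (\<Prod>i\<in>UNIV. (x $ i) ^ a i)"
    if "a \<in> exponents k" for a :: "'a \<Rightarrow> nat"
    using that by (simp add: power_mult_distrib prod.distrib exponents_def flip: power_sum)
  then show ?thesis
    using assms unfolding homogeneous_def
    by (auto simp: sum_distrib_left mult.left_commute intro!: sum.cong)
qed

lemma mem_zeros_point:
  assumes "homogeneous k f" and "v \<noteq> 0"
  shows "point v \<in> zeros f \<longleftrightarrow> f v = 0"
  using homogeneous_scale[OF assms(1), of _ v]
  by (auto simp: zeros_def line_of_point[OF assms(2)] dest: spec[of _ 1])

lemma zeros_mult:
  fixes f g :: "complex^'a::finite \<Rightarrow> complex"
  assumes "homogeneous j f" and "homogeneous k g"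
  shows "zeros (\<lambda>x. f x * g x) = zeros f \<union> zeros g"
proof (rule set_eqI)
  fix p :: "'a proj"
  obtain v where "v \<noteq> 0" "p = point v" by (rule point_cases)
  then show "p \<in> zeros (\<lambda>x. f x * g x) \<longleftrightarrow> p \<in> zeros f \<union> zeros g"
    using mem_zeros_point[OF homogeneous_mult[OF assms]] mem_zeros_point[OF assms(1)]
      mem_zeros_point[OF assms(2)] by simp
qed

lemma homogeneous_one: "homogeneous 0 (\<lambda>x::complex^'m::finite. 1)"
proof -
  have "exponents 0 = {\<lambda>i::'m. 0}" by (auto simp: exponents_def fun_eq_iff)
  then show ?thesis unfolding homogeneous_def by auto
qed

lemma zeros_one: "zeros (\<lambda>x. 1) = {}"
  using mem_zeros_point[OF homogeneous_one] by (metis equals0I point_cases zero_neq_one)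

text \<open>The closed sets are exactly the common zero sets of families of homogeneous polynomials.\<close>

lemma openin_zariski_iff:
  "openin zariski U \<longleftrightarrow>
    (\<exists>\<F>. (\<forall>f\<in>\<F>. \<exists>k. homogeneous k f) \<and> - U = (\<Inter>f\<in>\<F>. zeros f))"
    (is "_ \<longleftrightarrow> ?closed U")
proof
  assume "openin zariski U"
  then have "generate_topology_on {- zeros f | f. \<exists>k. homogeneous k f} U"
    by (simp add: zariski_def openin_topology_generated_by_iff)
  then show "?closed U"
  proof induction
    case Empty
    show ?case by (intro exI[of _ "{}"]) auto
  next
    case (Int A B)
    then obtain F G where F: "\<forall>f\<in>F. \<exists>k. homogeneous k f" "- A = (\<Inter>f\<in>F. zeros f)"
      and G: "\<forall>f\<in>G. \<exists>k. homogeneous k f" "- B = (\<Inter>f\<in>G. zeros f)" by blast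
    have m: "zeros (\<lambda>x. f x * g x) = zeros f \<union> zeros g" if "f \<in> F" "g \<in> G" for f g
      using that F(1) G(1) zeros_mult by blast
    show ?case
    proof (intro exI[of _ "{\<lambda>x. f x * g x | f g. f \<in> F \<and> g \<in> G}"] conjI)
      show "\<forall>h\<in>{\<lambda>x. f x * g x | f g. f \<in> F \<and> g \<in> G}. \<exists>k. homogeneous k h"
        using F(1) G(1) homogeneous_mult by blast
      have "- (A \<inter> B) = (\<Inter>f\<in>F. zeros f) \<union> (\<Inter>g\<in>G. zeros g)"
        using F(2) G(2) by blast
      also have "\<dots> = (\<Inter>f\<in>F. \<Inter>g\<in>G. zeros f \<union> zeros g)" by blast
      also have "\<dots> = (\<Inter>f\<in>F. \<Inter>g\<in>G. zeros (\<lambda>x. f x * g x))" using m by simp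
      also have "\<dots> = (\<Inter>h\<in>{\<lambda>x. f x * g x | f g. f \<in> F \<and> g \<in> G}. zeros h)" by blast
      finally show "- (A \<inter> B) = \<dots>" .
    qed
  next
    case (UN K)
    then obtain F where F: "\<And>A. A \<in> K \<Longrightarrow> (\<forall>f\<in>F A. \<exists>k. homogeneous k f)"
      "\<And>A. A \<in> K \<Longrightarrow> - A = (\<Inter>f\<in>F A. zeros f)" by metis
    have "- \<Union>K = (\<Inter>A\<in>K. - A)" by blast
    also have "\<dots> = (\<Inter>A\<in>K. \<Inter>f\<in>F A. zeros f)" using F(2) by simp
    also have "\<dots> = (\<Inter>f\<in>(\<Union>A\<in>K. F A). zeros f)" by blast
    finally show ?case using F(1) by (intro exI[of _ "\<Union>A\<in>K. F A"]) auto
  next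
    case (Basis A)
    then obtain f where "\<exists>k. homogeneous k f" "A = - zeros f" by blast
    then show ?case by (intro exI[of _ "{f}"]) auto
  qed
next
  assume "?closed U"
  then obtain F where F: "\<forall>f\<in>F. \<exists>k. homogeneous k f" "- U = (\<Inter>f\<in>F. zeros f)" by blast
  have "U = (\<Union>f\<in>F. - zeros f)" using F(2) by blast
  moreover have "openin zariski (- zeros f)" if "f \<in> F" for f
    unfolding zariski_def using F(1) that by (intro topology_generated_by_Basis) blast
  ultimately show "openin zariski U" by auto
qed

lemma topspace_zariski: "topspace zariski = UNIV"
proof -
  have "openin zariski (- zeros (\<lambda>x. 1))"
    unfolding openin_zariski_iff using homogeneous_one by (intro exI[of _ "{\<lambda>x. 1}"]) auto
  then show ?thesis using openin_subset by (fastforce simp: zeros_one)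
qed


section \<open>Projective linear spans and rational maps\<close>

definition proj_span :: "'m::finite proj set \<Rightarrow> 'm proj set"
  where "proj_span S = {p. line_of p \<subseteq> vec.span (\<Union>q\<in>S. line_of q)}"

text \<open>Intended for linear subspaces; the empty subspace gets dimension \<open>-1\<close>.\<close>

definition proj_dim :: "'m::finite proj set \<Rightarrow> int"
  where "proj_dim S = int (vec.dim (\<Union>q\<in>S. line_of q)) - 1"

text \<open>The rational map given by a tuple \<open>\<phi>\<close> of homogeneous polynomials of the same degree, as a
  partial function that is undefined at the common zeros of the tuple. The chosen representative
  of a point does not matter, by homogeneity.\<close>

definition rational_map ::
    "(complex^'m::finite \<Rightarrow> complex^'k::finite) \<Rightarrow> 'm proj \<rightharpoonup> 'k proj"
  where "rational_map \<phi> p =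
    (if \<exists>x\<in>line_of p. x \<noteq> 0 \<and> \<phi> x \<noteq> 0
     then Some (point (\<phi> (SOME x. x \<in> line_of p \<and> x \<noteq> 0 \<and> \<phi> x \<noteq> 0))) else None)"

definition map_image :: "('a \<rightharpoonup> 'b) \<Rightarrow> 'a set \<Rightarrow> 'b set"
  where "map_image f S = ran (f |` S)"

text \<open>Equality of a rational self-map of \<open>X\<close> with the identity: agreement on a dense open subset.\<close>

definition generically_id :: "'m::finite proj set \<Rightarrow> ('m proj \<rightharpoonup> 'm proj) \<Rightarrow> bool"
  where "generically_id X h \<longleftrightarrow>
    (\<exists>U. openin (subtopology zariski X) U \<and> X \<subseteq> zariski closure_of U \<and> (\<forall>p\<in>U. h p = Some p))"

definition rational_inverse ::
    "'m::finite proj set \<Rightarrow> 'k::finite proj set \<Rightarrow> ('m proj \<rightharpoonup> 'k proj) \<Rightarrow> ('k proj \<rightharpoonup> 'm proj) \<Rightarrow> bool"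
  where "rational_inverse X Y f g \<longleftrightarrow>
    dom f \<subseteq> X \<and> ran f \<subseteq> Y \<and> dom g \<subseteq> Y \<and> ran g \<subseteq> X \<and>
    generically_id X (g \<circ>\<^sub>m f) \<and> generically_id Y (f \<circ>\<^sub>m g)"

text \<open>The matrix \<open>B\<close> describes the linear projection with centre \<open>V\<close> onto the projective space
  with coordinates \<open>'m\<close>; it is determined by \<open>V\<close> up to the choice of coordinates on the target.\<close>

definition projection_from :: "'k::finite proj set \<Rightarrow> complex^'k^'m::finite \<Rightarrow> bool"
  where "projection_from V B \<longleftrightarrow>
    surj (\<lambda>w. B *v w) \<and> V = {q. \<forall>w\<in>line_of q. B *v w = 0}"


section \<open>Polytopes in projective space\<close>

text \<open>Homogeneous coordinates on \<open>n\<close>-dimensional projective space, \<open>n = CARD('n)\<close>, are indexed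
  by \<open>'n option\<close>. An invertible matrix \<open>M\<close> encodes an arbitrary affine chart: the standard chart,
  in which the coordinate at \<open>None\<close> is 1, followed by the projectivity given by \<open>M\<close>.\<close>

definition chart :: "complex^('n::finite option)^('n option) \<Rightarrow> real^'n \<Rightarrow> 'n option proj"
  where "chart M x =
    point (M *v (\<chi> j. case j of None \<Rightarrow> 1 | Some i \<Rightarrow> complex_of_real (x $ i)))"

definition facets :: "(real^'n::finite) set \<Rightarrow> (real^'n) set set"
  where "facets P = {F. F facet_of P}"

definition proj_face ::
    "complex^('n::finite option)^('n option) \<Rightarrow> (real^'n) set \<Rightarrow> 'n option proj set"
  where "proj_face M F = zariski closure_of (chart M ` F)"

definition proj_polytope ::
    "complex^('n::finite option)^('n option) \<Rightarrow> (real^'n) set \<Rightarrow> 'n option proj set set"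
  where "proj_polytope M P = {proj_face M F | F. F face_of P \<and> F \<noteq> {}}"

definition facet_hyperplane ::
    "complex^('n::finite option)^('n option) \<Rightarrow> (real^'n) set \<Rightarrow> 'n option proj set"
  where "facet_hyperplane M F = proj_span (proj_face M F)"

definition arrangement ::
    "complex^('n::finite option)^('n option) \<Rightarrow> (real^'n) set \<Rightarrow> 'n option proj set set"
  where "arrangement M P = facet_hyperplane M ` facets P"

definition simple_arrangement :: "'n::finite option proj set set \<Rightarrow> bool"
  where "simple_arrangement \<H> \<longleftrightarrow> (\<forall>p. card {H \<in> \<H>. p \<in> H} \<le> CARD('n))"

definition residual_arrangement ::
    "complex^('n::finite option)^('n option) \<Rightarrow> (real^'n) set \<Rightarrow> 'n option proj set"
  where "residual_arrangement M P =
    \<Union>{L. (\<exists>\<C>. \<C> \<subseteq> arrangement M P \<and> L = \<Inter>\<C>) \<and> (\<forall>G\<in>proj_polytope M P. \<not> G \<subseteq> L)}"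

text \<open>An equation of the adjoint hypersurface. The subtraction does not truncate, since a
  full-dimensional polytope has at least \<open>n + 1\<close> facets.\<close>

definition adjoint_equation ::
    "complex^('n::finite option)^('n option) \<Rightarrow> (real^'n) set \<Rightarrow> (complex^('n option) \<Rightarrow> complex) \<Rightarrow> bool"
  where "adjoint_equation M P \<alpha> \<longleftrightarrow>
    homogeneous (card (facets P) - CARD('n) - 1) \<alpha> \<and> \<alpha> \<noteq> (\<lambda>x. 0) \<and>
    residual_arrangement M P \<subseteq> zeros \<alpha>"

definition facet_equations ::
    "complex^('n::finite option)^('n option) \<Rightarrow> (real^'n) set \<Rightarrow>
      ((real^'n) set \<Rightarrow> complex^('n option) \<Rightarrow> complex) \<Rightarrow> bool"
  where "facet_equations M P l \<longleftrightarrow>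
    (\<forall>F\<in>facets P. homogeneous 1 (l F) \<and> zeros (l F) = facet_hyperplane M F)"

text \<open>The finite type \<open>'v\<close> indexes the vertices of \<open>P\<close>, so that \<open>N = CARD('v)\<close>.\<close>

definition vertex_enumeration :: "(real^'n::finite) set \<Rightarrow> ('v::finite \<Rightarrow> real^'n) \<Rightarrow> bool"
  where "vertex_enumeration P u \<longleftrightarrow> bij_betw u UNIV {v. v extreme_point_of P}"

text \<open>The target \<open>P(\<Omega>\<^sub>P\<^sup>*)\<close> carries the coordinates dual to the basis of \<open>\<Omega>\<^sub>P\<close> formed by
  these \<open>N\<close> products.\<close>

definition wachspress_map ::
    "(real^'n::finite) set \<Rightarrow> ((real^'n) set \<Rightarrow> complex^('n option) \<Rightarrow> complex) \<Rightarrow>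
      ('v::finite \<Rightarrow> real^'n) \<Rightarrow> 'n option proj \<rightharpoonup> 'v proj"
  where "wachspress_map P l u =
    rational_map (\<lambda>x. \<chi> j. \<Prod>F | F \<in> facets P \<and> u j \<notin> F. l F x)"

definition wachspress_variety ::
    "(real^'n::finite) set \<Rightarrow> ((real^'n) set \<Rightarrow> complex^('n option) \<Rightarrow> complex) \<Rightarrow>
      ('v::finite \<Rightarrow> real^'n) \<Rightarrow> 'v proj set"
  where "wachspress_variety P l u = zariski closure_of (map_image (wachspress_map P l u) UNIV)"

definition adjoint_image_span ::
    "(real^'n::finite) set \<Rightarrow> ((real^'n) set \<Rightarrow> complex^('n option) \<Rightarrow> complex) \<Rightarrow>
      ('v::finite \<Rightarrow> real^'n) \<Rightarrow> (complex^('n option) \<Rightarrow> complex) \<Rightarrow> 'v proj set"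
  where "adjoint_image_span P l u \<alpha> = proj_span (map_image (wachspress_map P l u) (zeros \<alpha>))"

end

theory Submission
  imports Defs "HOL-Computational_Algebra.Fundamental_Theorem_Algebra"
begin

text \<open>Write \<open>n\<close> for the dimension, \<open>d\<close> for the number of facets, \<open>l\<^sub>F\<close> for the form of a facet \<open>F\<close>, and for a
set \<open>S\<close> of \<open>n\<close> facets let \<open>\<pi>\<^sub>S\<close> be the product of the \<open>l\<^sub>F\<close> with \<open>F \<notin> S\<close>.  The \<open>n\<close> hyperplanes of \<open>S\<close> meet in
a point \<open>q\<^sub>S\<close>, and since the arrangement is simple no other facet form vanishes there.  Hence \<open>\<pi>\<^sub>S\<close>
vanishes at all these points except \<open>q\<^sub>S\<close>.  Moreover the \<open>\<pi>\<^sub>S\<close> span the forms of degree \<open>d - n\<close>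
(\<open>forms_spanned_by_products\<close>), so such a form is determined by its values at the points \<open>q\<^sub>S\<close>.
A vertex \<open>v\<close> of \<open>P\<close> lies on exactly \<open>n\<close> facets, so it is one of these points, and the corresponding
\<open>\<pi>\<^sub>S\<close> is the coordinate of the Wachspress map \<open>\<omega>\<close> at \<open>v\<close>; every \<open>q\<^sub>S\<close> that is not a vertex is a residual
point.  A form of degree \<open>d - n\<close> that vanishes at the residual points is therefore a linear combination
of the coordinates of \<open>\<omega>\<close>.

This applies to \<open>\<alpha> x * x $ i\<close> for the adjoint \<open>\<alpha>\<close> and each coordinate \<open>i\<close>
(\<open>adjoint_times_coordinate\<close>), and gives a matrix \<open>B\<close> with \<open>B *v \<omega> x = \<alpha> x *s x\<close>.  Off the adjoint
hypersurface \<open>B\<close> thus recovers \<open>x\<close> from \<open>\<omega> x\<close>, and the two rational maps are inverse to each other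
(\<open>rational_inverse_projection\<close>).

It remains to see that the centre of the projection, the kernel of \<open>B\<close>, is spanned by the image of the
adjoint hypersurface; the dimension is then \<open>N - (n + 1) - 1\<close>.  The kernel contains the image.  For the
converse take a functional that vanishes on the image.  It pulls back to a form \<open>f\<close> of degree one more
than \<open>\<alpha>\<close> that vanishes where \<open>\<alpha>\<close> does, and the point is to show that \<open>f\<close> is \<open>\<alpha>\<close> times a linear form: then
the functional is a combination of the rows of \<open>B\<close>.  This divisibility needs \<open>\<alpha>\<close> to have no
multiple factors.  Now \<open>\<alpha>\<close> does not vanish at some vertex \<open>v\<close>, since otherwise all \<open>\<alpha> x * x $ i\<close>
would be zero.  On the line cut out by all but one of the facets at \<open>v\<close>, the facets away from \<open>v\<close> cut out
\<open>d - n\<close> distinct points, of which at most one is a vertex and the others are residual; so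
\<open>\<alpha>\<close> has as many distinct zeros on this line as its degree (\<open>adjoint_distinct_zeros_on_line\<close>).  On a
nearby line through \<open>v\<close> the zeros are still distinct, so there \<open>f\<close> is \<open>\<alpha>\<close> times a polynomial of degree at most 1,
and comparing coefficients gives one linear form for all these lines
(\<open>linear_multiple_if_vanishing_on_hypersurface\<close>).\<close>

section \<open>Linear functionals and subspaces of complex coordinate space\<close>

lemma scalar_product_add_right: "scalar_product c (x + y) = scalar_product c x + scalar_product c y"
  by (simp add: scalar_product_def sum.distrib distrib_left)

lemma scalar_product_add_left: "scalar_product (b + c) x = scalar_product b x + scalar_product c x"
  by (simp add: scalar_product_def sum.distrib distrib_right)

lemma scalar_product_scale_right:
  "scalar_product c (t *s x) = t * scalar_product c (x :: complex^'m::finite)"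
  by (simp add: scalar_product_def sum_distrib_left mult.left_commute)

lemma scalar_product_scale_left:
  "scalar_product (t *s c) x = t * scalar_product c (x :: complex^'m::finite)"
  by (simp add: scalar_product_def sum_distrib_left mult.assoc)

lemma scalar_product_axis: "scalar_product (axis i 1) (x :: complex^'m::finite) = x $ i"
  by (simp add: scalar_product_def axis_def if_distrib[of "\<lambda>a. a * _"] cong: if_cong)

lemma scalar_product_commute: "scalar_product c x = scalar_product x (c :: complex^'m::finite)"
  by (simp add: scalar_product_def mult.commute)

lemma scalar_product_zero_right [simp]: "scalar_product c 0 = 0"
  by (simp add: scalar_product_def)

lemma scalar_product_zero_left [simp]: "scalar_product 0 x = 0"
  by (simp add: scalar_product_def)

lemma scalar_product_sum_left:
  "scalar_product (\<Sum>i\<in>I. c i) x = (\<Sum>i\<in>I. scalar_product (c i) x)"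
  by (simp add: scalar_product_def sum_distrib_right sum.swap[of _ I])

lemma scalar_product_matrix:
  fixes B :: "complex^'k::finite^'m::finite"
  shows "scalar_product c (B *v x) = scalar_product (c v* B) x"
  by (simp add: scalar_product_def matrix_vector_mult_def vector_matrix_mult_def sum_distrib_left
      sum_distrib_right mult_ac sum.swap[of _ "UNIV :: 'm set"])

lemma scalar_product_matrix_row:
  fixes B :: "complex^'k::finite^'m::finite"
  shows "(B *v x) $ i = scalar_product (B $ i) x"
  by (simp add: scalar_product_def matrix_vector_mult_def)

text \<open>The real orthogonal complement of a complex subspace is also the Hermitian one, because
  the subspace is closed under multiplication by \<open>\<i>\<close>; conjugating a Hermitian normal vector gives
  a functional.\<close>

lemma separating_functional:
  fixes S :: "(complex^'m::finite) set"
  assumes S: "vec.subspace S" and "w \<notin> S"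
  obtains y where "\<And>s. s \<in> S \<Longrightarrow> scalar_product y s = 0" and "scalar_product y w \<noteq> 0"
proof -
  have sub: "subspace S"
  proof -
    have "c *\<^sub>R x = complex_of_real c *s x" for c and x :: "complex^'m"
      unfolding vec_eq_iff
      by (metis scaleR_conv_of_real vector_scaleR_component vector_smult_component)
    then show ?thesis using S unfolding vec.subspace_def subspace_def by simp
  qed
  obtain s z where s: "s \<in> S" and z: "\<And>w. w \<in> S \<Longrightarrow> orthogonal z w" and w: "w = s + z"
    using orthogonal_subspace_decomp_exists[of S w] by (metis span_eq_iff sub)
  define y where "y = (\<chi> i. cnj (z $ i))"
  have re: "Re (scalar_product y x) = z \<bullet> x" for x
    by (simp add: y_def scalar_product_def inner_vec_def inner_complex_def)
  have kill: "scalar_product y x = 0" if "x \<in> S" for x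
  proof -
    have "\<i> *s x \<in> S" using that S by (simp add: vec.subspace_def)
    then have "Re (scalar_product y (\<i> *s x)) = 0" "Re (scalar_product y x) = 0"
      using z that by (auto simp: re orthogonal_def)
    then show ?thesis by (simp add: scalar_product_scale_right complex_eq_iff)
  qed
  have "z \<noteq> 0" using w s \<open>w \<notin> S\<close> by auto
  then have "Re (scalar_product y z) \<noteq> 0" by (simp add: re)
  then have "scalar_product y w \<noteq> 0"
    using kill[OF s] by (auto simp: w scalar_product_add_right)
  then show thesis using kill that by blast
qed

text \<open>The functionals span a proper subspace, and a vector that separates it from a point outside is
  a common zero.\<close>

lemma few_functionals_common_zero:
  fixes c :: "'f \<Rightarrow> complex^'m::finite"
  assumes "finite S" and "card S < CARD('m)"
  obtains y where "y \<noteq> 0" and "\<And>F. F \<in> S \<Longrightarrow> scalar_product (c F) y = 0"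
proof -
  have "vec.dim (c ` S) \<le> card (c ` S)" using assms by (simp add: vec.dim_le_card')
  also have "\<dots> \<le> card S" using assms by (simp add: card_image_le)
  finally have "vec.dim (c ` S) < CARD('m)" using assms by simp
  then have "vec.span (c ` S) \<noteq> UNIV"
    by (metis vec.dim_span vec.dim_UNIV card_cart_basis less_irrefl)
  then obtain w where "w \<notin> vec.span (c ` S)" by blast
  then obtain y where y: "\<And>s. s \<in> vec.span (c ` S) \<Longrightarrow> scalar_product y s = 0"
    and "scalar_product y w \<noteq> 0"
    using separating_functional[OF vec.subspace_span] by metis
  then have "y \<noteq> 0" by auto
  moreover have "scalar_product (c F) y = 0" if "F \<in> S" for F
    using y[of "c F"] that by (simp add: scalar_product_commute vec.span_base)
  ultimately show thesis using that by blast
qed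

text \<open>By duality: a functional outside the span of the \<open>c F\<close> could be separated from the span by a
  vector, and this vector would be a common zero of the \<open>c F\<close>.\<close>

lemma functionals_span:
  fixes c :: "'f \<Rightarrow> complex^'m::finite"
  assumes "\<And>y. (\<And>F. F \<in> S \<Longrightarrow> scalar_product (c F) y = 0) \<Longrightarrow> y = 0" and "finite S"
  obtains a where "\<And>y. scalar_product b y = (\<Sum>F\<in>S. a F * scalar_product (c F) y)"
proof -
  let ?R = "range (\<lambda>a. \<Sum>F\<in>S. a F *s c F)"
  have sub: "vec.subspace ?R"
    unfolding vec.subspace_def
  proof (intro conjI ballI allI)
    show "0 \<in> ?R" by (rule range_eqI[of _ _ "\<lambda>F. 0"]) simp
    show "x + y \<in> ?R" if xy: "x \<in> ?R" "y \<in> ?R" for x y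
    proof -
      obtain p q where "x = (\<Sum>F\<in>S. p F *s c F)" "y = (\<Sum>F\<in>S. q F *s c F)" using xy by blast
      then show ?thesis
        by (intro range_eqI[of _ _ "\<lambda>F. p F + q F"]) (simp add: sum.distrib vec.scale_left_distrib)
    qed
    show "t *s x \<in> ?R" if x: "x \<in> ?R" for t x
    proof -
      obtain p where "x = (\<Sum>F\<in>S. p F *s c F)" using x by blast
      then show ?thesis
        by (intro range_eqI[of _ _ "\<lambda>F. t * p F"]) (simp add: vec.scale_sum_right)
    qed
  qed
  have "b \<in> ?R"
  proof (rule ccontr)
    assume "b \<notin> ?R"
    then obtain y where y: "\<And>s. s \<in> ?R \<Longrightarrow> scalar_product y s = 0"
      and nz: "scalar_product y b \<noteq> 0"
      using separating_functional[OF sub \<open>b \<notin> ?R\<close>] by blast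
    have "c F \<in> ?R" if "F \<in> S" for F
      using that \<open>finite S\<close>
      by (intro range_eqI[of _ _ "\<lambda>G. if G = F then 1 else 0"])
        (simp add: if_distrib[of "\<lambda>t. t *s _"] cong: if_cong)
    then have "scalar_product (c F) y = 0" if "F \<in> S" for F
      using y[of "c F"] that by (simp add: scalar_product_commute)
    then have "y = 0" by (rule assms(1))
    then show False using nz by simp
  qed
  then obtain a where "b = (\<Sum>F\<in>S. a F *s c F)" by blast
  then show thesis using that[of a] by (simp add: scalar_product_sum_left scalar_product_scale_left)
qed

text \<open>A linear section of a surjection splits the source into the kernel and a copy of the target.\<close>

lemma dim_kernel_of_surjection:
  fixes B :: "complex^'k::finite^'m::finite"
  assumes "surj (\<lambda>w. B *v w)"
  shows "vec.dim {w. B *v w = 0} + CARD('m) = CARD('k)"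
proof -
  obtain g where g: "Vector_Spaces.linear (*s) (*s) g" and "(\<lambda>w. B *v w) \<circ> g = id"
    using vec.linear_surjective_right_inverse[OF matrix_vector_mul_linear_gen assms] by blast
  then have Bg: "B *v g x = x" for x by (metis comp_apply id_apply)
  have inj: "inj g" by (metis Bg injI)
  have sub: "vec.subspace {w. B *v w = 0}"
    by (auto simp: vec.subspace_def matrix_vector_right_distrib vector_scalar_commute)
  have sub2: "vec.subspace (range g)"
    using vec.linear_subspace_image[OF g vec.subspace_UNIV] .
  have int: "{w. B *v w = 0} \<inter> range g = {0}"
  proof (intro equalityI subsetI)
    fix w assume "w \<in> {w. B *v w = 0} \<inter> range g"
    then obtain x where "w = g x" "B *v g x = 0" by blast
    then show "w \<in> {0}" using vec.linear_0[OF g] by (simp add: Bg)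
  next
    fix w :: "complex^'k" assume "w \<in> {0}"
    then show "w \<in> {w. B *v w = 0} \<inter> range g"
      using rangeI[of g 0] vec.linear_0[OF g] by simp
  qed
  have "w \<in> {x + y |x y. x \<in> {w. B *v w = 0} \<and> y \<in> range g}" for w
  proof -
    have "w = (w - g (B *v w)) + g (B *v w)" by simp
    moreover have "B *v (w - g (B *v w)) = 0" by (simp add: matrix_vector_mult_diff_distrib Bg)
    ultimately show ?thesis by blast
  qed
  then have "{x + y |x y. x \<in> {w. B *v w = 0} \<and> y \<in> range g} = UNIV" by blast
  moreover have "vec.dim (range g) = CARD('m)"
    using vec.dim_image_eq[OF g, of UNIV] inj by (simp add: vec.dim_UNIV card_cart_basis)
  ultimately show ?thesis
    using vec.dim_sums_Int[OF sub sub2] by (simp add: int vec.dim_UNIV card_cart_basis)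
qed

section \<open>Homogeneous polynomial functions\<close>

lemma homogeneous_zero: "homogeneous k (\<lambda>x. 0)"
  unfolding homogeneous_def by (rule exI[of _ "\<lambda>a. 0"]) simp

lemma homogeneous_add:
  assumes "homogeneous k f" and "homogeneous k g"
  shows "homogeneous k (\<lambda>x. f x + g x)"
proof -
  obtain c d where "f = (\<lambda>x. \<Sum>a\<in>exponents k. c a * (\<Prod>i\<in>UNIV. (x $ i) ^ a i))"
    and "g = (\<lambda>x. \<Sum>a\<in>exponents k. d a * (\<Prod>i\<in>UNIV. (x $ i) ^ a i))"
    using assms unfolding homogeneous_def by blast
  then show ?thesis
    unfolding homogeneous_def
    by (intro exI[of _ "\<lambda>a. c a + d a"]) (simp add: sum.distrib distrib_right)
qed

lemma homogeneous_cmult: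
  assumes "homogeneous k f"
  shows "homogeneous k (\<lambda>x. t * f x)"
proof -
  obtain c where "f = (\<lambda>x. \<Sum>a\<in>exponents k. c a * (\<Prod>i\<in>UNIV. (x $ i) ^ a i))"
    using assms unfolding homogeneous_def by blast
  then show ?thesis
    unfolding homogeneous_def
    by (intro exI[of _ "\<lambda>a. t * c a"]) (simp add: sum_distrib_left mult.assoc)
qed

lemma homogeneous_diff:
  assumes "homogeneous k f" and "homogeneous k g"
  shows "homogeneous k (\<lambda>x. f x - g x)"
  using homogeneous_add[OF assms(1) homogeneous_cmult[OF assms(2), of "-1"]] by simp

lemma homogeneous_sum:
  assumes "\<And>i. i \<in> I \<Longrightarrow> homogeneous k (f i)"
  shows "homogeneous k (\<lambda>x. \<Sum>i\<in>I. f i x)"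
  using assms by (induction I rule: infinite_finite_induct)
    (auto intro: homogeneous_zero homogeneous_add)

lemma homogeneous_prod_linear:
  assumes "\<And>i. i \<in> I \<Longrightarrow> homogeneous 1 (f i)"
  shows "homogeneous (card I) (\<lambda>x. \<Prod>i\<in>I. f i x)"
  using assms
proof (induction I rule: infinite_finite_induct)
  case (insert i I)
  then show ?case using homogeneous_mult[of 1 "f i" "card I"] by simp
qed (simp_all add: homogeneous_one)

lemma homogeneous_coordinate: "homogeneous 1 (\<lambda>x :: complex^'m::finite. x $ i)"
proof -
  have e: "(\<lambda>j. if j = i then 1 else 0) \<in> exponents 1" by (simp add: exponents_def)
  have "(\<Prod>j\<in>UNIV. (x $ j) ^ (if j = i then 1 else 0)) = x $ i" for x :: "complex^'m"
    by (simp add: if_distrib[of "\<lambda>n. _ ^ n"] cong: if_cong)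
  then show ?thesis
    using homogeneous_sum_monomials[of "{()}" "\<lambda>_ j. if j = i then 1 else 0" 1 "\<lambda>_. 1"] e by simp
qed

lemma homogeneous_scalar_product: "homogeneous 1 (scalar_product c)"
  unfolding scalar_product_def[abs_def]
  by (intro homogeneous_sum homogeneous_cmult homogeneous_coordinate)

lemma homogeneous_at_zero:
  assumes "homogeneous (Suc k) f"
  shows "f 0 = 0"
  using homogeneous_scale[OF assms, of 0 0] by simp

text \<open>The monomials arise from the constant 1 by repeated multiplication by coordinates.\<close>

lemma homogeneous_induct [consumes 1, case_names one times zero add scale]:
  fixes f :: "complex^'m::finite \<Rightarrow> complex"
  assumes "homogeneous k f"
    and one: "P 0 (\<lambda>x. 1)"
    and times: "\<And>k f i. homogeneous k f \<Longrightarrow> P k f \<Longrightarrow> P (Suc k) (\<lambda>x. x $ i * f x)"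
    and zero: "\<And>k. P k (\<lambda>x. 0)"
    and add: "\<And>k f g. P k f \<Longrightarrow> P k g \<Longrightarrow> P k (\<lambda>x. f x + g x)"
    and scale: "\<And>k f c. P k f \<Longrightarrow> P k (\<lambda>x. c * f x)"
  shows "P k f"
proof -
  have mono: "homogeneous k (\<lambda>x. \<Prod>i\<in>UNIV. (x $ i) ^ a i) \<and> P k (\<lambda>x. \<Prod>i\<in>UNIV. (x $ i) ^ a i)"
    if "(\<Sum>i\<in>UNIV. a i) = k" for a :: "'m \<Rightarrow> nat" and k
    using that
  proof (induction k arbitrary: a)
    case 0
    then show ?case using one homogeneous_one by simp
  next
    case (Suc k)
    then obtain i where i: "a i \<noteq> 0" by (metis sum.neutral nat.distinct(1))
    define b where "b = a(i := a i - 1)"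
    have "sum a UNIV = a i + sum a (UNIV - {i})" "sum b UNIV = b i + sum b (UNIV - {i})"
      by (simp_all add: sum.remove)
    moreover have "sum b (UNIV - {i}) = sum a (UNIV - {i})" by (simp add: b_def)
    ultimately have "sum b UNIV = k" using i Suc.prems by (simp add: b_def)
    then have IH: "homogeneous k (\<lambda>x. \<Prod>i\<in>UNIV. (x $ i) ^ b i)"
      "P k (\<lambda>x. \<Prod>i\<in>UNIV. (x $ i) ^ b i)" using Suc.IH by auto
    have "(\<Prod>j\<in>UNIV. (x $ j) ^ a j) = x $ i * (\<Prod>j\<in>UNIV. (x $ j) ^ b j)" for x :: "complex^'m"
    proof -
      have "(\<Prod>j\<in>UNIV - {i}. (x $ j) ^ b j) = (\<Prod>j\<in>UNIV - {i}. (x $ j) ^ a j)"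
        by (simp add: b_def)
      moreover have "(x $ i) ^ a i = x $ i * (x $ i) ^ b i"
        using i by (simp add: b_def flip: power_Suc)
      ultimately show ?thesis
        by (simp add: prod.remove[of UNIV i])
    qed
    then show ?case
      using times[OF IH, of i] homogeneous_mult[OF homogeneous_coordinate IH(1), of i] by simp
  qed
  obtain c where f: "f = (\<lambda>x. \<Sum>a\<in>exponents k. c a * (\<Prod>i\<in>UNIV. (x $ i) ^ a i))"
    using assms(1) unfolding homogeneous_def by blast
  have "P k (\<lambda>x. \<Sum>a\<in>A. c a * (\<Prod>i\<in>UNIV. (x $ i) ^ a i))" if "A \<subseteq> exponents k" for A
    using finite_subset[OF that finite_exponents] that
  proof (induction A rule: finite_induct)
    case empty
    then show ?case using zero by simp
  next
    case (insert a A)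
    then have "P k (\<lambda>x. c a * (\<Prod>i\<in>UNIV. (x $ i) ^ a i))"
      using mono[of a k] scale by (auto simp: exponents_def)
    then show ?case using insert add by simp
  qed
  then show ?thesis unfolding f by simp
qed

lemma homogeneous_compose_matrix:
  fixes B :: "complex^'k::finite^'m::finite"
  assumes "homogeneous k f"
  shows "homogeneous k (\<lambda>x. f (B *v x))"
  using assms
proof (induction rule: homogeneous_induct)
  case (times k f i)
  show ?case
    using homogeneous_mult[OF homogeneous_scalar_product[of "B $ i"] times.IH]
    by (simp add: matrix_vector_mult_def scalar_product_def)
qed (auto intro: homogeneous_one homogeneous_zero homogeneous_add homogeneous_cmult)

lemma continuous_on_homogeneous:
  fixes f :: "complex^'m::finite \<Rightarrow> complex"
  assumes "homogeneous k f"
  shows "continuous_on UNIV f"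
  using assms by (induction rule: homogeneous_induct) (auto intro!: continuous_intros)

subsection \<open>Restriction to lines\<close>

text \<open>A substitute for polynomial functions of unspecified degree: it suffices that on each line
  there are only finitely many zeros or none but zeros.\<close>

definition polynomial_on_lines :: "(complex^'m::finite \<Rightarrow> complex) \<Rightarrow> bool"
  where "polynomial_on_lines f \<longleftrightarrow> (\<forall>a b. \<exists>p. \<forall>t. poly p t = f (a + t *s b))"

lemma polynomial_on_lines_const: "polynomial_on_lines (\<lambda>x. c)"
  unfolding polynomial_on_lines_def by (intro allI exI[of _ "[:c:]"]) simp

lemma polynomial_on_lines_coordinate: "polynomial_on_lines (\<lambda>x :: complex^'m::finite. x $ i)"
  unfolding polynomial_on_lines_def
proof (intro allI)
  show "\<exists>p. \<forall>t. poly p t = (a + t *s b) $ i" for a b :: "complex^'m"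
    by (intro exI[of _ "[:a $ i, b $ i:]"]) simp
qed

lemma polynomial_on_lines_add:
  assumes "polynomial_on_lines f" and "polynomial_on_lines g"
  shows "polynomial_on_lines (\<lambda>x. f x + g x)"
  using assms unfolding polynomial_on_lines_def by (metis poly_add)

lemma polynomial_on_lines_mult:
  assumes "polynomial_on_lines f" and "polynomial_on_lines g"
  shows "polynomial_on_lines (\<lambda>x. f x * g x)"
  using assms unfolding polynomial_on_lines_def by (metis poly_mult)

lemma polynomial_on_lines_compose:
  fixes \<phi> :: "complex^'m::finite \<Rightarrow> complex^'k::finite"
  assumes "homogeneous k f" and "\<And>j. polynomial_on_lines (\<lambda>x. \<phi> x $ j)"
  shows "polynomial_on_lines (\<lambda>x. f (\<phi> x))"
  using assms(1)
  by (induction rule: homogeneous_induct)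
    (auto intro: assms(2) polynomial_on_lines_const polynomial_on_lines_add polynomial_on_lines_mult)

lemma polynomial_on_lines_homogeneous: "homogeneous k f \<Longrightarrow> polynomial_on_lines f"
  by (rule polynomial_on_lines_compose[of k f "\<lambda>x. x"]) (auto intro: polynomial_on_lines_coordinate)

text \<open>Two polynomials that do not vanish identically do not vanish identically on the line joining
  a nonzero of the one to a nonzero of the other, so they have a common nonzero there.\<close>

lemma polynomial_on_lines_common_nonzero:
  fixes f g :: "complex^'m::finite \<Rightarrow> complex"
  assumes "polynomial_on_lines f" and "polynomial_on_lines g" and "f x \<noteq> 0" and "g y \<noteq> 0"
  obtains z where "f z \<noteq> 0" and "g z \<noteq> 0"
proof -
  obtain p q where p: "\<And>t. poly p t = f (x + t *s (y - x))"
    and q: "\<And>t. poly q t = g (x + t *s (y - x))"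
    using assms(1,2) unfolding polynomial_on_lines_def by blast
  have "poly p 0 \<noteq> 0" "poly q 1 \<noteq> 0" using assms(3,4) by (simp_all add: p q)
  then have "p * q \<noteq> 0" by auto
  then have "finite {t. poly (p * q) t = 0}" by (rule poly_roots_finite)
  then obtain t where "poly (p * q) t \<noteq> 0"
    by (metis (mono_tags, lifting) UNIV_I ex_new_if_finite infinite_UNIV_char_0 mem_Collect_eq)
  then have "f (x + t *s (y - x)) \<noteq> 0" "g (x + t *s (y - x)) \<noteq> 0" unfolding p[symmetric] q[symmetric] by auto
  then show thesis by (rule that)
qed

text \<open>On the line from \<open>x0\<close> to \<open>y\<close> there are infinitely many zeros near \<open>x0\<close>.\<close>

lemma polynomial_on_lines_zero_if_zero_near:
  fixes f :: "complex^'m::finite \<Rightarrow> complex"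
  assumes "polynomial_on_lines f" and "\<delta> > 0" and near: "\<And>x. dist x x0 < \<delta> \<Longrightarrow> f x = 0"
  shows "f y = 0"
proof -
  obtain p where p: "\<And>t. poly p t = f (x0 + t *s (y - x0))"
    using assms(1) unfolding polynomial_on_lines_def by meson
  have "((\<lambda>t::complex. x0 + t *s (y - x0)) \<longlongrightarrow> x0 + 0 *s (y - x0)) (nhds 0)"
    unfolding vector_scalar_mult_def by (intro tendsto_intros filterlim_ident)
  then have "\<forall>\<^sub>F t in nhds (0::complex). dist (x0 + t *s (y - x0)) x0 < \<delta>"
    using assms(2) by (auto simp: tendsto_iff)
  then have "\<forall>\<^sub>F t in nhds (0::complex). poly p t = 0"
    by (rule eventually_mono) (simp add: p near)
  then obtain e where "e > 0" and e: "\<And>t. dist t 0 < e \<Longrightarrow> poly p t = 0"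
    unfolding eventually_nhds_metric by blast
  have "p = 0"
  proof (rule ccontr)
    assume "p \<noteq> 0"
    then have "finite {t. poly p t = 0}" by (rule poly_roots_finite)
    moreover have "ball 0 e \<subseteq> {t. poly p t = 0}" using e by (auto simp: dist_commute)
    ultimately have "finite (ball (0::complex) e)" by (rule finite_subset[rotated])
    then show False using \<open>e > 0\<close> countable_finite uncountable_ball by blast
  qed
  then show ?thesis using p[of 1] by simp
qed

text \<open>On the line through \<open>v\<close> with direction \<open>x\<close> the linear coefficient of a form is its derivative at
  \<open>v\<close> in direction \<open>x\<close>, hence linear in \<open>x\<close>, and its top coefficient is its value at \<open>x\<close>.\<close>

lemma homogeneous_expansion_on_line:
  fixes f :: "complex^'m::finite \<Rightarrow> complex"
  assumes "homogeneous k f"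
  obtains g where "\<And>x. \<exists>p. degree p \<le> k \<and> (\<forall>s. poly p s = f (v + s *s x)) \<and>
      coeff p 1 = scalar_product g x \<and> coeff p k = f x"
proof -
  define Q where "Q k f \<longleftrightarrow> (\<exists>g. \<forall>x. \<exists>p. degree p \<le> k \<and> (\<forall>s. poly p s = f (v + s *s x)) \<and>
      coeff p 1 = scalar_product g x \<and> coeff p k = f x)"
    for k and f :: "complex^'m \<Rightarrow> complex"
  have "Q k f"
    using assms
  proof (induction rule: homogeneous_induct)
    case one
    show ?case unfolding Q_def
      by (intro exI[of _ 0] allI exI[of _ "1 :: complex poly"]) simp
  next
    case (times k f i)
    then obtain g where g: "\<And>x. \<exists>p. degree p \<le> k \<and> (\<forall>s. poly p s = f (v + s *s x)) \<and>
      coeff p 1 = scalar_product g x \<and> coeff p k = f x" unfolding Q_def by blast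
    show ?case unfolding Q_def
    proof (intro exI[of _ "v $ i *s g + f v *s axis i 1"] allI)
      fix x
      obtain p where p: "degree p \<le> k" "\<And>s. poly p s = f (v + s *s x)"
        "coeff p 1 = scalar_product g x" "coeff p k = f x" using g by blast
      have p0: "coeff p 0 = f v" using p(2)[of 0] by (simp add: poly_0_coeff_0)
      show "\<exists>p. degree p \<le> Suc k \<and> (\<forall>s. poly p s = (v + s *s x) $ i * f (v + s *s x)) \<and>
        coeff p 1 = scalar_product (v $ i *s g + f v *s axis i 1) x \<and> coeff p (Suc k) = x $ i * f x"
      proof (intro exI[of _ "[:v $ i, x $ i:] * p"] conjI allI)
        show "degree ([:v $ i, x $ i:] * p) \<le> Suc k"
          using p(1) degree_mult_le[of "[:v $ i, x $ i:]" p] by (auto split: if_splits)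
        show "coeff ([:v $ i, x $ i:] * p) 1 = scalar_product (v $ i *s g + f v *s axis i 1) x"
          using p(3) p0 by (simp add: scalar_product_add_left scalar_product_scale_left
              scalar_product_axis)
        show "coeff ([:v $ i, x $ i:] * p) (Suc k) = x $ i * f x"
          using p(1,4) by (simp add: coeff_eq_0)
      qed (simp add: p(2) algebra_simps)
    qed
  next
    case (zero k)
    show ?case unfolding Q_def
      by (intro exI[of _ 0] allI exI[of _ "0 :: complex poly"]) simp
  next
    case (add k f g)
    then obtain a b where a: "\<And>x. \<exists>p. degree p \<le> k \<and> (\<forall>s. poly p s = f (v + s *s x)) \<and>
      coeff p 1 = scalar_product a x \<and> coeff p k = f x"
      and b: "\<And>x. \<exists>p. degree p \<le> k \<and> (\<forall>s. poly p s = g (v + s *s x)) \<and>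
      coeff p 1 = scalar_product b x \<and> coeff p k = g x" unfolding Q_def by blast
    show ?case unfolding Q_def
    proof (intro exI[of _ "a + b"] allI)
      fix x
      obtain p q where "degree p \<le> k" "\<And>s. poly p s = f (v + s *s x)"
        "coeff p 1 = scalar_product a x" "coeff p k = f x"
        "degree q \<le> k" "\<And>s. poly q s = g (v + s *s x)"
        "coeff q 1 = scalar_product b x" "coeff q k = g x" using a b by meson
      then show "\<exists>p. degree p \<le> k \<and> (\<forall>s. poly p s = f (v + s *s x) + g (v + s *s x)) \<and>
        coeff p 1 = scalar_product (a + b) x \<and> coeff p k = f x + g x"
        by (intro exI[of _ "p + q"]) (simp add: degree_add_le scalar_product_add_left)
    qed
  next
    case (scale k f c)
    then obtain a where a: "\<And>x. \<exists>p. degree p \<le> k \<and> (\<forall>s. poly p s = f (v + s *s x)) \<and>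
      coeff p 1 = scalar_product a x \<and> coeff p k = f x" unfolding Q_def by blast
    show ?case unfolding Q_def
    proof (intro exI[of _ "c *s a"] allI)
      fix x
      obtain p where "degree p \<le> k" "\<And>s. poly p s = f (v + s *s x)"
        "coeff p 1 = scalar_product a x" "coeff p k = f x" using a by meson
      then show "\<exists>p. degree p \<le> k \<and> (\<forall>s. poly p s = c * f (v + s *s x)) \<and>
        coeff p 1 = scalar_product (c *s a) x \<and> coeff p k = c * f x"
        by (intro exI[of _ "smult c p"])
          (auto simp: scalar_product_scale_left intro: order_trans[OF degree_smult_le])
    qed
  qed
  then show thesis using that unfolding Q_def by blast
qed

lemma homogeneous_one_imp_scalar_product:
  fixes f :: "complex^'m::finite \<Rightarrow> complex"
  assumes "homogeneous 1 f"
  obtains c where "f = scalar_product c"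
proof -
  obtain c where "\<And>x. \<exists>p. coeff p 1 = scalar_product c x \<and> coeff p 1 = f x"
    using homogeneous_expansion_on_line[OF assms, of 0] by metis
  then show thesis by (intro that[of c]) (metis ext)
qed

section \<open>Forms vanishing on a hypersurface\<close>

text \<open>The absolute value of a polynomial at \<open>t\<close> is that of its leading coefficient times the product of
  the distances from \<open>t\<close> to the roots, so a small value forces a root nearby.\<close>

lemma poly_root_near:
  fixes p :: "complex poly"
  assumes "degree p = n" and "\<epsilon> > 0" and "norm (poly p t) < norm (lead_coeff p) * \<epsilon> ^ n"
  shows "\<exists>r. poly p r = 0 \<and> dist r t < \<epsilon>"
  using assms
proof (induction n arbitrary: p)
  case 0
  then obtain c where "p = [:c:]" by (metis degree_eq_zeroE)
  then show ?case using 0 by simp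
next
  case (Suc n)
  then obtain r where r: "poly p r = 0" using alg_closed_imp_poly_has_root[of p] by auto
  show ?case
  proof (cases "dist r t < \<epsilon>")
    case False
    obtain q where q: "p = [:- r, 1:] * q" using r by (metis dvdE poly_eq_0_iff_dvd)
    have "q \<noteq> 0" using q Suc.prems(1) by auto
    then have deg: "degree q = n" using Suc.prems(1) unfolding q by (subst (asm) degree_mult_eq) auto
    have lc: "lead_coeff p = lead_coeff q" unfolding q by (simp only: lead_coeff_mult) simp
    have "poly p t = (t - r) * poly q t" by (simp add: q algebra_simps)
    then have "norm (poly p t) = dist r t * norm (poly q t)"
      by (simp add: norm_mult dist_norm norm_minus_commute)
    then have "\<epsilon> * norm (poly q t) \<le> norm (poly p t)"
      using False by (simp add: mult_right_mono)
    then have "\<epsilon> * norm (poly q t) < \<epsilon> * (norm (lead_coeff q) * \<epsilon> ^ n)"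
      using Suc.prems(3) lc by (simp add: mult.left_commute)
    then have "norm (poly q t) < norm (lead_coeff q) * \<epsilon> ^ n"
      using Suc.prems(2) by simp
    then obtain s where "poly q s = 0" "dist s t < \<epsilon>" using Suc.IH deg Suc.prems(2) by blast
    then show ?thesis by (auto simp: q)
  qed (use r in blast)
qed

lemma finite_set_separated:
  fixes T :: "'a::metric_space set"
  assumes "finite T"
  obtains \<epsilon> where "\<epsilon> > 0" and "\<And>s t. s \<in> T \<Longrightarrow> t \<in> T \<Longrightarrow> s \<noteq> t \<Longrightarrow> 2 * \<epsilon> \<le> dist s t"
proof -
  let ?D = "insert 1 ((\<lambda>(s, t). dist s t) ` (T \<times> T - Id))"
  have fin: "finite ?D" using assms by simp
  have "Min ?D > 0" using fin by (subst Min_gr_iff) auto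
  moreover have "Min ?D \<le> dist s t" if "s \<in> T" "t \<in> T" "s \<noteq> t" for s t
    using that by (intro Min_le[OF fin]) force
  ultimately show thesis by (intro that[of "Min ?D / 2"]) auto
qed

text \<open>As a polynomial in \<open>t\<close>, \<open>\<alpha> (x + t *s v)\<close> has the leading coefficient \<open>\<alpha> v\<close> for every \<open>x\<close>.
  If \<open>x\<close> is near \<open>x0\<close>, its value at a root for \<open>x0\<close> is small, so that it has a root nearby; around
  distinct roots these are distinct.\<close>

lemma simple_roots_persist:
  fixes \<alpha> :: "complex^'m::finite \<Rightarrow> complex"
  assumes hom: "homogeneous D \<alpha>" and "\<alpha> v \<noteq> 0"
    and "finite T" and "card T = D" and root: "\<And>t. t \<in> T \<Longrightarrow> \<alpha> (x0 + t *s v) = 0"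
  obtains \<delta> where "\<delta> > 0"
    and "\<And>x. dist x x0 < \<delta> \<Longrightarrow> \<exists>T'. finite T' \<and> card T' = D \<and> (\<forall>t\<in>T'. \<alpha> (x + t *s v) = 0)"
proof -
  obtain \<epsilon> where "\<epsilon> > 0" and sep: "\<And>s t. s \<in> T \<Longrightarrow> t \<in> T \<Longrightarrow> s \<noteq> t \<Longrightarrow> 2 * \<epsilon> \<le> dist s t"
    using finite_set_separated[OF \<open>finite T\<close>] by metis
  have small: "\<forall>\<^sub>F x in nhds x0. norm (\<alpha> (x + t *s v)) < norm (\<alpha> v) * \<epsilon> ^ D" if "t \<in> T" for t
  proof -
    have "continuous_on UNIV (\<lambda>x. \<alpha> (x + t *s v))"
      by (rule continuous_on_compose2[OF continuous_on_homogeneous[OF hom], of UNIV "\<lambda>x. x + t *s v"])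
        (auto intro!: continuous_intros)
    then have "((\<lambda>x. \<alpha> (x + t *s v)) \<longlongrightarrow> \<alpha> (x0 + t *s v)) (nhds x0)"
      using tendsto_at_iff_tendsto_nhds[of "\<lambda>x. \<alpha> (x + t *s v)" x0]
      by (simp add: continuous_on_eq_continuous_at isCont_def)
    moreover have "0 < norm (\<alpha> v) * \<epsilon> ^ D" using assms(2) \<open>\<epsilon> > 0\<close> by simp
    ultimately show ?thesis using root[OF that] by (simp add: tendsto_iff)
  qed
  have "\<forall>\<^sub>F x in nhds x0. \<forall>t\<in>T. norm (\<alpha> (x + t *s v)) < norm (\<alpha> v) * \<epsilon> ^ D"
    using \<open>finite T\<close> small by (simp add: eventually_ball_finite)
  then obtain \<delta> where "\<delta> > 0" and \<delta>: "\<And>x t. dist x x0 < \<delta> \<Longrightarrow> t \<in> T \<Longrightarrow>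
      norm (\<alpha> (x + t *s v)) < norm (\<alpha> v) * \<epsilon> ^ D"
    unfolding eventually_nhds_metric by blast
  have "\<exists>T'. finite T' \<and> card T' = D \<and> (\<forall>t\<in>T'. \<alpha> (x + t *s v) = 0)" if "dist x x0 < \<delta>" for x
  proof -
    obtain p where p: "degree p \<le> D" "\<And>s. poly p s = \<alpha> (x + s *s v)" "coeff p D = \<alpha> v"
      using homogeneous_expansion_on_line[OF hom, of x] by metis
    have deg: "degree p = D" using p assms(2) by (metis le_antisym le_degree)
    have "\<exists>r. \<alpha> (x + r *s v) = 0 \<and> dist r t < \<epsilon>" if "t \<in> T" for t
      using poly_root_near[OF deg \<open>\<epsilon> > 0\<close>, of t] \<delta>[OF \<open>dist x x0 < \<delta>\<close> that] p(2,3) deg by auto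
    then obtain r where r: "\<And>t. t \<in> T \<Longrightarrow> \<alpha> (x + r t *s v) = 0 \<and> dist (r t) t < \<epsilon>" by metis
    have "inj_on r T"
    proof (rule inj_onI, rule ccontr)
      fix s t assume st: "s \<in> T" "t \<in> T" "r s = r t" "s \<noteq> t"
      then have "dist s t < 2 * \<epsilon>"
        using r[OF st(1)] r[OF st(2)] dist_triangle3[of s t "r s"] by simp
      then show False using sep st by force
    qed
    then show ?thesis
      using r \<open>finite T\<close> \<open>card T = D\<close> by (intro exI[of _ "r ` T"]) (auto simp: card_image)
  qed
  then show thesis using that \<open>\<delta> > 0\<close> by blast
qed

text \<open>On the line through \<open>v\<close> with direction \<open>x\<close>, for \<open>x\<close> near \<open>x0\<close>, the form \<open>\<alpha>\<close> has \<open>D\<close> distinct zeros and \<open>f\<close> vanishes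
  at them, so the quotient is a polynomial \<open>b + e * s\<close>.  Its top coefficient gives
  \<open>f x = e * \<alpha> x\<close>, and the linear terms on both sides of \<open>f = \<alpha> * (b + e * s)\<close> show that \<open>e\<close> is linear
  in \<open>x\<close>, because \<open>b\<close> is the quotient of the values at \<open>v\<close>.  What holds near \<open>x0\<close> holds everywhere.\<close>

lemma linear_multiple_if_vanishing_on_hypersurface:
  fixes \<alpha> :: "complex^'m::finite \<Rightarrow> complex"
  assumes hom: "homogeneous D \<alpha>" "homogeneous (Suc D) f" and v: "\<alpha> v \<noteq> 0"
    and T: "finite T" "card T = D" "\<And>t. t \<in> T \<Longrightarrow> \<alpha> (x0 + t *s v) = 0"
    and vanish: "\<And>x. \<alpha> x = 0 \<Longrightarrow> f x = 0"
  obtains c where "\<And>x. f x = \<alpha> x * scalar_product c x"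
proof -
  obtain g where g: "\<And>x. \<exists>p. degree p \<le> D \<and> (\<forall>s. poly p s = \<alpha> (v + s *s x)) \<and>
      coeff p 1 = scalar_product g x \<and> coeff p D = \<alpha> x"
    using homogeneous_expansion_on_line[OF hom(1)] by metis
  obtain h where h: "\<And>x. \<exists>p. degree p \<le> Suc D \<and> (\<forall>s. poly p s = f (v + s *s x)) \<and>
      coeff p 1 = scalar_product h x \<and> coeff p (Suc D) = f x"
    using homogeneous_expansion_on_line[OF hom(2)] by metis
  define b where "b = f v / \<alpha> v"
  define c where "c = (1 / \<alpha> v) *s h + (- b / \<alpha> v) *s g"
  obtain \<delta> where "\<delta> > 0" and near: "\<And>x. dist x x0 < \<delta> \<Longrightarrow>
      \<exists>T'. finite T' \<and> card T' = D \<and> (\<forall>t\<in>T'. \<alpha> (x + t *s v) = 0)"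
    using simple_roots_persist[OF hom(1) v T] by blast
  define r where "r x = f x - \<alpha> x * scalar_product c x" for x
  have hom_r: "homogeneous (Suc D) r"
    using homogeneous_diff[OF hom(2) homogeneous_mult[OF hom(1) homogeneous_scalar_product, of c,
          unfolded One_nat_def add_Suc_right add_0_right]]
    by (simp add: r_def[abs_def])
  have "r x = 0" if "dist x x0 < \<delta>" "\<alpha> x \<noteq> 0" for x
  proof -
    obtain T' where T': "finite T'" "card T' = D" "\<And>t. t \<in> T' \<Longrightarrow> \<alpha> (x + t *s v) = 0"
      using near \<open>dist x x0 < \<delta>\<close> by blast
    obtain p where p: "degree p \<le> D" "\<And>s. poly p s = \<alpha> (v + s *s x)"
      "coeff p 1 = scalar_product g x" "coeff p D = \<alpha> x" using g by metis
    obtain q where q: "degree q \<le> Suc D" "\<And>s. poly q s = f (v + s *s x)"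
      "coeff q 1 = scalar_product h x" "coeff q (Suc D) = f x" using h by metis
    define e where "e = f x / \<alpha> x"
    \<comment> \<open>\<open>b\<close> and \<open>e\<close> are chosen to kill the constant term and the coefficient of degree \<open>Suc D\<close>, which
      leaves a polynomial of degree at most \<open>D\<close> with \<open>Suc D\<close> roots.\<close>
    define u where "u = q - [:b, e:] * p"
    have p0: "coeff p 0 = \<alpha> v" using p(2)[of 0] by (simp add: poly_0_coeff_0)
    have "degree ([:b, e:] * p) \<le> Suc D"
      using p(1) degree_mult_le[of "[:b, e:]" p] by (auto split: if_splits)
    then have "degree u \<le> Suc D" unfolding u_def using q(1) by (simp add: degree_diff_le)
    moreover have "coeff u (Suc D) = 0"
      using p(1,4) q(4) \<open>\<alpha> x \<noteq> 0\<close> by (simp add: u_def e_def coeff_eq_0)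
    ultimately have deg: "degree u \<le> D"
      by (metis le_antisym leading_coeff_0_iff degree_0 not_less_eq_eq zero_le)
    \<comment> \<open>The roots \<open>t\<close> parametrize the points \<open>x + t *s v\<close>; their inverses parametrize the same
      projective points as \<open>v + s *s x\<close>.\<close>
    have nz: "0 \<notin> T'" using T'(3)[of 0] \<open>\<alpha> x \<noteq> 0\<close> by auto
    have roots: "poly u s = 0" if s: "s \<in> insert 0 (inverse ` T')" for s
    proof (cases "s = 0")
      case True
      then show ?thesis using p(2)[of 0] q(2)[of 0] v by (simp add: u_def b_def)
    next
      case False
      then obtain t where t: "t \<in> T'" "s = inverse t" using s by blast
      then have "t \<noteq> 0" using nz by auto
      then have "v + s *s x = s *s (x + t *s v)" using t by (simp add: vec_eq_iff field_simps)
      then have "\<alpha> (v + s *s x) = s ^ D * \<alpha> (x + t *s v)"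
        using homogeneous_scale[OF hom(1), of s "x + t *s v"] by argo
      then have "\<alpha> (v + s *s x) = 0" using T'(3)[OF t(1)] by simp
      then show ?thesis using p(2) q(2) vanish by (simp add: u_def)
    qed
    have "u = 0"
    proof (rule ccontr)
      assume "u \<noteq> 0"
      then have "card {s. poly u s = 0} \<le> D"
        by (rule order_trans[OF card_poly_roots_bound deg])
      moreover have "card (insert 0 (inverse ` T')) = Suc D"
        using T'(1,2) nz by (subst card_insert_disjoint) (auto simp: card_image inj_on_def)
      moreover have "insert 0 (inverse ` T') \<subseteq> {s. poly u s = 0}" using roots by blast
      ultimately show False
        using card_mono[OF poly_roots_finite[OF \<open>u \<noteq> 0\<close>], of "insert 0 (inverse ` T')"] by linarith
    qed
    then have "coeff u 1 = 0" by simp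
    then have "scalar_product h x = b * scalar_product g x + e * \<alpha> v"
      using p(3) q(3) p0 by (simp add: u_def)
    then have "scalar_product c x = e"
      using v unfolding c_def scalar_product_scale_left scalar_product_add_left
      by (simp add: field_simps)
    then show ?thesis using \<open>\<alpha> x \<noteq> 0\<close> by (simp add: r_def e_def)
  qed
  then have local_zero: "\<alpha> x * r x = 0" if "dist x x0 < \<delta>" for x using that by force
  have poly: "polynomial_on_lines \<alpha>" "polynomial_on_lines r"
    using hom(1) hom_r polynomial_on_lines_homogeneous by blast+
  have prod_zero: "\<alpha> x * r x = 0" for x
    using polynomial_on_lines_zero_if_zero_near[OF polynomial_on_lines_mult[OF poly] \<open>\<delta> > 0\<close> local_zero] .
  have "r x = 0" for x
  proof (rule ccontr)
    assume "r x \<noteq> 0"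
    then obtain z where "\<alpha> z \<noteq> 0" "r z \<noteq> 0"
      using polynomial_on_lines_common_nonzero[OF poly v] by metis
    then show False using prod_zero[of z] by simp
  qed
  then show thesis using that[of c] by (simp add: r_def)
qed


section \<open>Forms and hyperplanes in general position\<close>

text \<open>Induction on the degree.  In a product of a coordinate with \<open>\<Prod>F\<in>T - S. l F\<close>, the coordinate
  is a linear combination of the \<open>l F\<close> with \<open>F \<in> S\<close> and one further form \<open>l G\<close>; multiplying by
  \<open>l F\<close> exchanges \<open>F\<close> for \<open>G\<close> in \<open>S\<close>.  The sets \<open>S\<close> have one element less than there are variables,
  so that with \<open>l G\<close> there are just enough forms for a basis.\<close>

lemma forms_spanned_by_products:
  fixes l :: "'f \<Rightarrow> complex^'m::finite \<Rightarrow> complex"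
  assumes "homogeneous k f" and "finite T" and "card T + 1 = CARD('m) + k"
    and "\<forall>F\<in>T. homogeneous 1 (l F)"
    and "\<forall>S y. S \<subseteq> T \<longrightarrow> card S = CARD('m) \<longrightarrow> (\<forall>F\<in>S. l F y = 0) \<longrightarrow> y = 0"
  shows "\<exists>c. \<forall>x. f x = (\<Sum>S | S \<subseteq> T \<and> card S + 1 = CARD('m). c S * (\<Prod>F\<in>T - S. l F x))"
  using assms
proof (induction arbitrary: T rule: homogeneous_induct)
  case one
  then have "S = T" if "S \<subseteq> T" "card S + 1 = CARD('m)" for S
    using that by (simp add: card_subset_eq)
  then have "{S. S \<subseteq> T \<and> card S + 1 = CARD('m)} = {T}" using one by auto
  then show ?case by (intro exI[of _ "\<lambda>S. 1"]) simp
next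
  case (times k f i)
  note fin = \<open>finite T\<close>
  have lin: "homogeneous 1 (l F)" if "F \<in> T" for F
    using times.prems(3) that by blast
  have gen: "y = 0" if "S \<subseteq> T" "card S = CARD('m)" "\<And>F. F \<in> S \<Longrightarrow> l F y = 0" for S y
    using times.prems(4) that by blast
  have card: "card T = CARD('m) + k" using times.prems(2) by simp
  then have "T \<noteq> {}" by (metis card.empty add_is_0 zero_less_card_finite less_irrefl)
  then obtain G where G: "G \<in> T" by blast
  define U where "U = T - {G}"
  have U: "U \<subseteq> T" "finite U" "G \<notin> U" "T = insert G U" "card U + 1 = CARD('m) + k"
    using G fin card by (auto simp: U_def)
  define I where "I V = {S. S \<subseteq> V \<and> card S + 1 = CARD('m)}" for V :: "'f set"
  define \<pi> where "\<pi> S x = (\<Prod>F\<in>T - S. l F x)" for S x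
  define E where "E = {f. \<exists>c. \<forall>x. f x = (\<Sum>S\<in>I T. c S * \<pi> S x)}"
  have finI: "finite (I T)" using fin by (simp add: I_def)
  have E_sum: "(\<lambda>x. \<Sum>j\<in>J. a j * g j x) \<in> E" if "\<And>j. j \<in> J \<Longrightarrow> g j \<in> E" for J :: "'j set" and a g
  proof -
    obtain c where "\<And>j x. j \<in> J \<Longrightarrow> g j x = (\<Sum>S\<in>I T. c j S * \<pi> S x)"
      using \<open>\<And>j. j \<in> J \<Longrightarrow> g j \<in> E\<close> unfolding E_def by simp metis
    then have "(\<Sum>j\<in>J. a j * g j x) = (\<Sum>S\<in>I T. (\<Sum>j\<in>J. a j * c j S) * \<pi> S x)" for x
      by (simp add: sum_distrib_left sum_distrib_right sum.swap[of _ J] mult.assoc)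
    then show ?thesis unfolding E_def by (intro CollectI exI[of _ "\<lambda>S. \<Sum>j\<in>J. a j * c j S"]) blast
  qed
  have E_base: "\<pi> S \<in> E" if "S \<in> I T" for S
    unfolding E_def using finI that
    by (auto intro!: exI[of _ "\<lambda>R. if R = S then 1 else 0"] simp: if_distrib[of "\<lambda>t. t * _"]
        cong: if_cong)
  have step: "(\<lambda>x. x $ i * (\<Prod>F\<in>U - S. l F x)) \<in> E" if "S \<in> I U" for S
  proof -
    have S: "S \<subseteq> U" "finite S" "card S + 1 = CARD('m)" "G \<notin> S"
      using that U finite_subset by (auto simp: I_def)
    have "\<exists>c. l F = scalar_product c" if "F \<in> T" for F
      using homogeneous_one_imp_scalar_product[OF lin[OF that]] by blast
    then obtain c where c: "\<And>F. F \<in> T \<Longrightarrow> l F = scalar_product (c F)" by metis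
    have sub: "insert G S \<subseteq> T" using S U by auto
    have "y = 0" if "\<And>F. F \<in> insert G S \<Longrightarrow> scalar_product (c F) y = 0" for y
      using that c sub S by (intro gen[OF sub, of y]) auto
    moreover have "finite (insert G S)" using S by simp
    ultimately obtain a where a: "\<And>y. scalar_product (axis i 1) y =
        (\<Sum>F\<in>insert G S. a F * scalar_product (c F) y)"
      using functionals_span[of "insert G S" c "axis i 1"] by metis
    have "x $ i = (\<Sum>F\<in>insert G S. a F * l F x)" for x
    proof -
      have "x $ i = (\<Sum>F\<in>insert G S. a F * scalar_product (c F) x)"
        unfolding a[symmetric] by (rule scalar_product_axis[symmetric])
      also have "\<dots> = (\<Sum>F\<in>insert G S. a F * l F x)" using sub c by (intro sum.cong) auto
      finally show ?thesis .
    qed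
    then have eq: "(\<lambda>x. x $ i * (\<Prod>F\<in>U - S. l F x)) =
        (\<lambda>x. \<Sum>F\<in>insert G S. a F * (l F x * (\<Prod>F\<in>U - S. l F x)))"
      by (simp add: fun_eq_iff sum_distrib_right mult.assoc del: sum.insert)
    have "(\<lambda>x. l F x * (\<Prod>F\<in>U - S. l F x)) \<in> E" if F: "F \<in> insert G S" for F
    proof -
      let ?R = "insert G S - {F}"
      have "T - ?R = insert F (U - S)" using F S U by auto
      moreover have "F \<notin> U - S" using F U by auto
      ultimately have "\<pi> ?R = (\<lambda>x. l F x * (\<Prod>F\<in>U - S. l F x))"
        using U by (simp add: \<pi>_def fun_eq_iff)
      moreover have "?R \<in> I T" using F S sub by (auto simp: I_def)
      ultimately show ?thesis using E_base by metis
    qed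
    then show ?thesis unfolding eq by (rule E_sum)
  qed
  have "\<exists>c. \<forall>x. f x = (\<Sum>S | S \<subseteq> U \<and> card S + 1 = CARD('m). c S * (\<Prod>F\<in>U - S. l F x))"
  proof (rule times.IH)
    show "\<forall>F\<in>U. homogeneous 1 (l F)" using lin U by blast
    show "\<forall>S y. S \<subseteq> U \<longrightarrow> card S = CARD('m) \<longrightarrow> (\<forall>F\<in>S. l F y = 0) \<longrightarrow> y = 0"
      using gen U(1) by blast
  qed (use U in auto)
  then obtain c where "\<And>x. f x = (\<Sum>S\<in>I U. c S * (\<Prod>F\<in>U - S. l F x))"
    unfolding I_def by blast
  then have "(\<lambda>x. x $ i * f x) = (\<lambda>x. \<Sum>S\<in>I U. c S * (x $ i * (\<Prod>F\<in>U - S. l F x)))"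
    by (simp add: fun_eq_iff sum_distrib_left mult.left_commute)
  also have "\<dots> \<in> E" using step by (rule E_sum)
  finally show ?case unfolding E_def I_def \<pi>_def by simp
next
  case (zero k)
  show ?case by (intro exI[of _ "\<lambda>S. 0"]) simp
next
  case (add k f g)
  obtain c d where
    "\<forall>x. f x = (\<Sum>S | S \<subseteq> T \<and> card S + 1 = CARD('m). c S * (\<Prod>F\<in>T - S. l F x))"
    "\<forall>x. g x = (\<Sum>S | S \<subseteq> T \<and> card S + 1 = CARD('m). d S * (\<Prod>F\<in>T - S. l F x))"
    using add.IH[OF add.prems] by blast
  then show ?case
    by (intro exI[of _ "\<lambda>S. c S + d S"]) (simp add: distrib_right sum.distrib)
next
  case (scale k f c)
  obtain d where
    "\<forall>x. f x = (\<Sum>S | S \<subseteq> T \<and> card S + 1 = CARD('m). d S * (\<Prod>F\<in>T - S. l F x))"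
    using scale.IH[OF scale.prems] by blast
  then show ?case
    by (intro exI[of _ "\<lambda>S. c * d S"]) (simp add: sum_distrib_left mult.assoc)
qed

section \<open>Points, closures and rational maps\<close>

lemma point_scale:
  assumes "c \<noteq> 0"
  shows "point (c *s v) = point v"
proof -
  have "range (\<lambda>a. a *s (c *s v)) = range (\<lambda>a. a *s v)"
  proof (intro equalityI image_subsetI)
    show "a *s (c *s v) \<in> range (\<lambda>a. a *s v)" for a
      by (rule range_eqI[of _ _ "a * c"]) simp
    show "a *s v \<in> range (\<lambda>a. a *s (c *s v))" for a
      by (rule range_eqI[of _ _ "a / c"]) (simp add: assms)
  qed
  then show ?thesis by (simp add: point_def)
qed

text \<open>Proportionality expressed by polynomial equations, so that it passes to Zariski closures.\<close>

lemma point_eqI_minors: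
  fixes v w :: "complex^'m::finite"
  assumes "v \<noteq> 0" and "w \<noteq> 0" and minors: "\<And>i j. v $ i * w $ j = v $ j * w $ i"
  shows "point v = point w"
proof -
  obtain j where j: "w $ j \<noteq> 0" using \<open>w \<noteq> 0\<close> by (auto simp: vec_eq_iff)
  have v: "v = (v $ j / w $ j) *s w"
    using j minors[of _ j] by (simp add: vec_eq_iff field_simps)
  then have "v $ j / w $ j \<noteq> 0" using \<open>v \<noteq> 0\<close> by auto
  then show ?thesis using point_scale v by metis
qed

lemma point_in_line: "v \<noteq> 0 \<Longrightarrow> v \<in> line_of (point v)"
  by (auto simp: line_of_point intro: range_eqI[of _ _ 1])

lemma line_of_subset_subspace_iff:
  assumes "vec.subspace S" and "v \<noteq> 0"
  shows "line_of (point v) \<subseteq> S \<longleftrightarrow> v \<in> S"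
  using assms point_in_line[of v] by (auto simp: line_of_point vec.subspace_scale)

lemma closedin_zeros: "homogeneous k f \<Longrightarrow> closedin zariski (zeros f)"
  unfolding closedin_def topspace_zariski Compl_eq_Diff_UNIV[symmetric] openin_zariski_iff
  by (auto intro!: exI[of _ "{f}"])

lemma zariski_closure_subset_zeros:
  assumes "homogeneous k f" and "S \<subseteq> zeros f"
  shows "zariski closure_of S \<subseteq> zeros f"
  by (rule closure_of_minimal[OF assms(2) closedin_zeros[OF assms(1)]])

lemma in_zariski_closureI:
  assumes "\<And>k f. homogeneous k f \<Longrightarrow> S \<subseteq> zeros f \<Longrightarrow> p \<in> zeros f"
  shows "p \<in> zariski closure_of S"
  unfolding in_closure_of topspace_zariski
proof (intro conjI allI impI UNIV_I)
  fix T assume T: "p \<in> T \<and> openin zariski T"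
  then obtain \<F> where \<F>: "\<forall>f\<in>\<F>. \<exists>k. homogeneous k f" "- T = (\<Inter>f\<in>\<F>. zeros f)"
    unfolding openin_zariski_iff by blast
  then obtain f where f: "f \<in> \<F>" "p \<notin> zeros f" using T by blast
  then obtain y where "y \<in> S" "y \<notin> zeros f" using assms \<F>(1) by blast
  then show "\<exists>y. y \<in> S \<and> y \<in> T" using \<F>(2) f(1) by blast
qed

lemma subset_zariski_closure: "S \<subseteq> zariski closure_of S"
  by (simp add: closure_of_subset topspace_zariski)

text \<open>A linear subspace is Zariski closed, being cut out by the functionals that vanish on it.\<close>

lemma proj_span_closure_points:
  assumes "0 \<notin> V"
  shows "proj_span (zariski closure_of (point ` V)) = {p. line_of p \<subseteq> vec.span V}"
proof -
  have "w \<in> vec.span V" if "p \<in> zariski closure_of (point ` V)" "w \<in> line_of p" for p w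
  proof (rule ccontr)
    assume "w \<notin> vec.span V"
    then obtain y where y: "\<And>s. s \<in> vec.span V \<Longrightarrow> scalar_product y s = 0"
      and "scalar_product y w \<noteq> 0"
      using separating_functional[OF vec.subspace_span] by metis
    have "point ` V \<subseteq> zeros (scalar_product y)"
    proof
      fix q assume "q \<in> point ` V"
      then obtain v where "v \<in> V" "q = point v" by blast
      then show "q \<in> zeros (scalar_product y)"
        using assms y[of v] mem_zeros_point[OF homogeneous_scalar_product, of v y]
        by (auto simp: vec.span_base)
    qed
    then have "p \<in> zeros (scalar_product y)"
      using that(1) zariski_closure_subset_zeros[OF homogeneous_scalar_product] by blast
    then show False using that(2) \<open>scalar_product y w \<noteq> 0\<close> by (simp add: zeros_def)
  qed
  then have "(\<Union>q\<in>zariski closure_of (point ` V). line_of q) \<subseteq> vec.span V" by blast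
  moreover have "V \<subseteq> (\<Union>q\<in>zariski closure_of (point ` V). line_of q)"
  proof
    fix v assume "v \<in> V"
    then have "point v \<in> zariski closure_of (point ` V)" "v \<in> line_of (point v)"
      using subset_zariski_closure[of "point ` V"] assms by (blast, metis point_in_line)
    then show "v \<in> (\<Union>q\<in>zariski closure_of (point ` V). line_of q)" by blast
  qed
  ultimately have "vec.span (\<Union>q\<in>zariski closure_of (point ` V). line_of q) = vec.span V"
    by (metis vec.span_eq vec.span_mono vec.span_span subset_antisym)
  then show ?thesis by (simp add: proj_span_def)
qed

lemma rational_map_point:
  fixes \<phi> :: "complex^'m::finite \<Rightarrow> complex^'k::finite"
  assumes hom: "\<And>j. homogeneous e (\<lambda>x. \<phi> x $ j)" and "v \<noteq> 0"
  shows "rational_map \<phi> (point v) = (if \<phi> v = 0 then None else Some (point (\<phi> v)))"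
proof -
  have scale: "\<phi> (c *s x) = c ^ e *s \<phi> x" for c x
    using homogeneous_scale[OF hom] by (simp add: vec_eq_iff)
  let ?Q = "\<lambda>x. x \<in> line_of (point v) \<and> x \<noteq> 0 \<and> \<phi> x \<noteq> 0"
  show ?thesis
  proof (cases "\<phi> v = 0")
    case True
    then have "\<not> ?Q x" for x by (auto simp: line_of_point[OF \<open>v \<noteq> 0\<close>] scale)
    then show ?thesis using True by (auto simp: rational_map_def)
  next
    case False
    then have "?Q v" using point_in_line \<open>v \<noteq> 0\<close> by blast
    then have ex: "\<exists>x\<in>line_of (point v). x \<noteq> 0 \<and> \<phi> x \<noteq> 0" and Q: "?Q (SOME x. ?Q x)"
      by (blast, rule someI)
    then obtain c where c: "(SOME x. ?Q x) = c *s v" by (auto simp: line_of_point[OF \<open>v \<noteq> 0\<close>])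
    then have "c \<noteq> 0" using Q by auto
    then have "point (\<phi> (SOME x. ?Q x)) = point (\<phi> v)" unfolding c scale
      by (intro point_scale) simp
    then show ?thesis using ex False by (simp add: rational_map_def)
  qed
qed

section \<open>Inverting a rational map by a linear projection\<close>

text \<open>Where \<open>\<alpha>\<close> does not vanish, \<open>B\<close> recovers the point \<open>x\<close> from \<open>\<phi> x\<close>.  Conversely \<open>w\<close> is
  proportional to \<open>\<phi> (B w)\<close> for \<open>w\<close> in the image of \<open>\<phi>\<close>, and this is a Zariski closed condition, so
  that it extends to the closure of the image.  The open sets on which this works are dense, since
  a product of nonzero polynomials in \<open>x\<close> is not zero.\<close>

lemma rational_inverse_projection:
  fixes \<phi> :: "complex^'m::finite \<Rightarrow> complex^'k::finite" and B :: "complex^'k^'m"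
  assumes hom: "\<And>j. homogeneous (Suc D) (\<lambda>x. \<phi> x $ j)" and hom_\<alpha>: "homogeneous D \<alpha>"
    and nz: "\<alpha> x0 \<noteq> 0" "x0 \<noteq> 0" and B: "\<And>x. B *v \<phi> x = \<alpha> x *s x"
  defines "W \<equiv> zariski closure_of (map_image (rational_map \<phi>) UNIV)"
  shows "rational_inverse UNIV W (rational_map \<phi>) (rational_map (\<lambda>w. B *v w) |` W)"
proof -
  let ?f = "rational_map \<phi>" and ?g = "rational_map (\<lambda>w. B *v w)"
  note f = rational_map_point[of "Suc D" \<phi>, OF hom]
  have hom_B: "homogeneous 1 (\<lambda>w. (B *v w) $ i)" for i
    unfolding scalar_product_matrix_row by (rule homogeneous_scalar_product)
  note g = rational_map_point[of 1 "\<lambda>w. B *v w", OF hom_B]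
  have \<phi>0: "\<phi> 0 = 0" using homogeneous_at_zero[OF hom] by (simp add: vec_eq_iff)
  have UNIV: "map_image ?f UNIV = ran ?f"
    by (simp add: map_image_def restrict_map_def)
  have image_W: "ran ?f \<subseteq> W"
    unfolding W_def UNIV by (rule subset_zariski_closure)
  have image: "ran ?f = {point (\<phi> x) | x. \<phi> x \<noteq> 0}"
  proof (intro equalityI subsetI)
    fix q assume "q \<in> ran ?f"
    then obtain p where "?f p = Some q" by (auto simp: ran_def)
    moreover obtain v where "v \<noteq> 0" "p = point v" by (rule point_cases)
    ultimately show "q \<in> {point (\<phi> x) | x. \<phi> x \<noteq> 0}" using f by (auto split: if_splits)
  next
    fix q assume "q \<in> {point (\<phi> x) | x. \<phi> x \<noteq> 0}"
    then obtain x where x: "q = point (\<phi> x)" "\<phi> x \<noteq> 0" by blast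
    then have "x \<noteq> 0" using \<phi>0 by auto
    then show "q \<in> ran ?f" using f[of x] x by (metis ranI)
  qed
  have W: "W = zariski closure_of {point (\<phi> x) | x. \<phi> x \<noteq> 0}"
    unfolding W_def UNIV image ..
  have \<phi>_nz: "\<phi> x \<noteq> 0" if "\<alpha> x \<noteq> 0" "x \<noteq> 0" for x
    using B[of x] that by (auto simp: vector_mul_eq_0)
  have scale: "\<phi> (c *s x) = c ^ Suc D *s \<phi> x" for c x
    using homogeneous_scale[OF hom] by (simp add: vec_eq_iff)
  note poly_\<alpha> = polynomial_on_lines_homogeneous[OF hom_\<alpha>]
  note poly_\<phi> = polynomial_on_lines_homogeneous[OF hom]

  have "generically_id UNIV ((?g |` W) \<circ>\<^sub>m ?f)"
    unfolding generically_id_def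
  proof (intro exI conjI ballI)
    show "openin (subtopology zariski UNIV) (- zeros \<alpha>)"
      using closedin_zeros[OF hom_\<alpha>] by (simp add: closedin_def topspace_zariski Compl_eq_Diff_UNIV)
    show "UNIV \<subseteq> zariski closure_of (- zeros \<alpha>)"
    proof (intro subsetI in_zariski_closureI)
      fix p :: "'m proj" and k f assume h: "homogeneous k f" "- zeros \<alpha> \<subseteq> zeros f"
      have "f z = 0" if "z \<noteq> 0" for z
      proof (rule ccontr)
        assume "f z \<noteq> 0"
        \<comment> \<open>The factor \<open>y $ i\<close> keeps the common nonzero \<open>y\<close> away from the origin.\<close>
        obtain i where i: "x0 $ i \<noteq> 0" using nz(2) by (auto simp: vec_eq_iff)
        obtain y where y: "\<alpha> y * y $ i \<noteq> 0" "f y \<noteq> 0"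
          using polynomial_on_lines_common_nonzero[OF polynomial_on_lines_mult[OF poly_\<alpha>
                polynomial_on_lines_coordinate] polynomial_on_lines_homogeneous[OF h(1)], of x0 i z]
            \<open>f z \<noteq> 0\<close> i nz(1) by auto
        then have "y \<noteq> 0" by auto
        then show False using h(2) y mem_zeros_point[OF hom_\<alpha>, of y] mem_zeros_point[OF h(1), of y] by auto
      qed
      then show "p \<in> zeros f" by (metis mem_zeros_point[OF h(1)] point_cases)
    qed
    fix p assume p: "p \<in> - zeros \<alpha>"
    obtain v where v: "v \<noteq> 0" "p = point v" by (rule point_cases)
    then have a: "\<alpha> v \<noteq> 0" using p mem_zeros_point[OF hom_\<alpha>] by blast
    have "?f p = Some (point (\<phi> v))" using f v \<phi>_nz[OF a] by simp
    moreover have "point (\<phi> v) \<in> W" using image_W calculation ranI by fast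
    moreover have "?g (point (\<phi> v)) = Some (point (\<alpha> v *s v))"
      using g[OF \<phi>_nz[OF a v(1)]] a v(1) by (simp add: B vector_mul_eq_0)
    ultimately show "((?g |` W) \<circ>\<^sub>m ?f) p = Some p" using v point_scale[OF a] by (simp add: map_comp_def)
  qed

  moreover have "generically_id W (?f \<circ>\<^sub>m (?g |` W))"
    unfolding generically_id_def
  proof (intro exI conjI ballI)
    \<comment> \<open>Besides \<open>\<alpha> (B *v w) \<noteq> 0\<close>, the point \<open>w\<close> has to avoid the centre \<open>B *v w = 0\<close> of the projection,
      on which a constant \<open>\<alpha>\<close> does not vanish.\<close>
    let ?h = "\<lambda>i w. \<alpha> (B *v w) * (B *v w) $ i"
    let ?Z = "\<Inter>i. zeros (?h i)"
    have hom_h: "homogeneous (D + 1) (?h i)" for i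
      by (rule homogeneous_mult[OF homogeneous_compose_matrix[OF hom_\<alpha>] hom_B])
    have Z: "point w \<in> ?Z \<longleftrightarrow> \<alpha> (B *v w) = 0 \<or> B *v w = 0" if "w \<noteq> 0" for w
      using mem_zeros_point[OF hom_h that] by (auto simp: vec_eq_iff)
    have "closedin zariski ?Z" using closedin_zeros[OF hom_h] by (intro closedin_INT) auto
    then show "openin (subtopology zariski W) (W \<inter> - ?Z)"
      by (auto simp: closedin_def topspace_zariski Compl_eq_Diff_UNIV openin_subtopology)
    show "W \<subseteq> zariski closure_of (W \<inter> - ?Z)"
      unfolding W
    proof (intro closure_of_minimal subsetI closedin_closure_of in_zariski_closureI, clarify)
      fix k h x
      assume h: "homogeneous k h"
        "zariski closure_of {point (\<phi> x) |x. \<phi> x \<noteq> 0} \<inter> - ?Z \<subseteq> zeros h"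
        and x: "\<phi> x \<noteq> 0"
      show "point (\<phi> x) \<in> zeros h"
      proof (rule ccontr)
        assume "point (\<phi> x) \<notin> zeros h"
        then have hx: "h (\<phi> x) \<noteq> 0" using mem_zeros_point[OF h(1) x] by simp
        obtain i where i: "x0 $ i \<noteq> 0" using nz(2) by (auto simp: vec_eq_iff)
        obtain y where y: "\<alpha> y * y $ i \<noteq> 0" "h (\<phi> y) \<noteq> 0"
          using polynomial_on_lines_common_nonzero[OF polynomial_on_lines_mult[OF poly_\<alpha>
                polynomial_on_lines_coordinate] polynomial_on_lines_compose[OF h(1) poly_\<phi>], of x0 i x]
            hx i nz(1) by auto
        then have nzy: "\<phi> y \<noteq> 0" using \<phi>_nz[of y] by force
        have "y \<noteq> 0" using y by auto
        then have "point (\<phi> y) \<notin> ?Z"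
          using y Z[OF nzy] by (auto simp: B homogeneous_scale[OF hom_\<alpha>])
        moreover have "point (\<phi> y) \<in> zariski closure_of {point (\<phi> x) |x. \<phi> x \<noteq> 0}"
          using nzy by (intro subsetD[OF subset_zariski_closure]) blast
        ultimately have "point (\<phi> y) \<in> zeros h" using h(2) by blast
        then show False using y(2) mem_zeros_point[OF h(1) nzy] by simp
      qed
    qed
    fix q assume q: "q \<in> W \<inter> - ?Z"
    obtain w where w: "w \<noteq> 0" "q = point w" by (rule point_cases)
    then have a: "\<alpha> (B *v w) \<noteq> 0" and Bw: "B *v w \<noteq> 0" using q Z[OF w(1)] by auto
    have "w $ i * \<phi> (B *v w) $ j = w $ j * \<phi> (B *v w) $ i" for i j
    proof -
      let ?k = "\<lambda>w. w $ i * \<phi> (B *v w) $ j - w $ j * \<phi> (B *v w) $ i"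
      have hom_k: "homogeneous (1 + Suc D) ?k"
        using homogeneous_compose_matrix[OF hom]
        by (intro homogeneous_diff homogeneous_mult homogeneous_coordinate)
      have "{point (\<phi> x) | x. \<phi> x \<noteq> 0} \<subseteq> zeros ?k"
      proof clarify
        fix x assume x: "\<phi> x \<noteq> 0"
        then show "point (\<phi> x) \<in> zeros ?k"
          using mem_zeros_point[OF hom_k x] by (simp add: B scale)
      qed
      then have "q \<in> zeros ?k"
        using q zariski_closure_subset_zeros[OF hom_k] unfolding W by blast
      then show ?thesis using mem_zeros_point[OF hom_k w(1)] w(2) by simp
    qed
    then have "point w = point (\<phi> (B *v w))"
      by (intro point_eqI_minors w(1) \<phi>_nz[OF a Bw])
    then show "(?f \<circ>\<^sub>m (?g |` W)) q = Some q"
      using q w g[OF w(1)] f[OF Bw] Bw \<phi>_nz[OF a Bw] by (simp add: map_comp_def)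
  qed
  ultimately show ?thesis
    unfolding rational_inverse_def using image_W by auto
qed

text \<open>A functional that vanishes on the image of the hypersurface \<open>\<alpha> = 0\<close> pulls back to a form
  \<open>\<alpha> x * scalar_product c x\<close>, which is also the pullback of the combination \<open>c\<close> of the rows of
  \<open>B\<close>.  So the image and the kernel of \<open>B\<close> are killed by the same functionals.\<close>

lemma projection_from_hypersurface_image:
  fixes \<phi> :: "complex^'m::finite \<Rightarrow> complex^'k::finite" and B :: "complex^'k^'m"
  assumes hom: "\<And>j. homogeneous (Suc D) (\<lambda>x. \<phi> x $ j)" and hom_\<alpha>: "homogeneous D \<alpha>"
    and nz: "\<alpha> x0 \<noteq> 0" and B: "\<And>x. B *v \<phi> x = \<alpha> x *s x"
    and indep: "\<And>y. (\<And>x. scalar_product y (\<phi> x) = 0) \<Longrightarrow> y = 0"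
    and multiple: "\<And>y. (\<And>x. \<alpha> x = 0 \<Longrightarrow> scalar_product y (\<phi> x) = 0) \<Longrightarrow>
      \<exists>c. \<forall>x. scalar_product y (\<phi> x) = \<alpha> x * scalar_product c x"
  defines "V \<equiv> proj_span (map_image (rational_map \<phi>) (zeros \<alpha>))"
  shows "projection_from V B" and "proj_dim V = int CARD('k) - int CARD('m) - 1"
proof -
  let ?I = "map_image (rational_map \<phi>) (zeros \<alpha>)"
  let ?K = "{w. B *v w = 0}"
  note f = rational_map_point[of "Suc D" \<phi>, OF hom]
  have \<phi>0: "\<phi> 0 = 0" using homogeneous_at_zero[OF hom] by (simp add: vec_eq_iff)
  have image: "?I = {point (\<phi> x) | x. \<phi> x \<noteq> 0 \<and> \<alpha> x = 0}"
  proof (intro equalityI subsetI)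
    fix q assume "q \<in> ?I"
    then obtain p where p: "p \<in> zeros \<alpha>" "rational_map \<phi> p = Some q"
      by (auto simp: map_image_def ran_def restrict_map_def split: if_splits)
    obtain v where v: "v \<noteq> 0" "p = point v" by (rule point_cases)
    then have "\<alpha> v = 0" "q = point (\<phi> v)" "\<phi> v \<noteq> 0"
      using p f[OF v(1)] mem_zeros_point[OF hom_\<alpha> v(1)] by (auto split: if_splits)
    then show "q \<in> {point (\<phi> x) | x. \<phi> x \<noteq> 0 \<and> \<alpha> x = 0}" by blast
  next
    fix q assume "q \<in> {point (\<phi> x) | x. \<phi> x \<noteq> 0 \<and> \<alpha> x = 0}"
    then obtain x where x: "q = point (\<phi> x)" "\<phi> x \<noteq> 0" "\<alpha> x = 0" by blast
    then have "x \<noteq> 0" using \<phi>0 by auto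
    then have "(rational_map \<phi> |` zeros \<alpha>) (point x) = Some q"
      using f[of x] x mem_zeros_point[OF hom_\<alpha>, of x] by (simp add: restrict_map_def)
    then show "q \<in> ?I" unfolding map_image_def by (rule ranI)
  qed
  have subK: "vec.subspace ?K"
    by (auto simp: vec.subspace_def matrix_vector_right_distrib vector_scalar_commute)
  have surj: "surj (\<lambda>w. B *v w)"
  proof (rule ccontr)
    assume "\<not> surj (\<lambda>w. B *v w)"
    then obtain z where "z \<notin> range (\<lambda>w. B *v w)" by blast
    then obtain y where y: "\<And>s. s \<in> range (\<lambda>w. B *v w) \<Longrightarrow> scalar_product y s = 0"
      and "scalar_product y z \<noteq> 0"
      using separating_functional[OF vec.linear_subspace_image[OF matrix_vector_mul_linear_gen
            vec.subspace_UNIV, of B]] by metis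
    then obtain x where "\<alpha> x \<noteq> 0" "scalar_product y x \<noteq> 0"
      using polynomial_on_lines_common_nonzero[OF polynomial_on_lines_homogeneous[OF hom_\<alpha>]
          polynomial_on_lines_homogeneous[OF homogeneous_scalar_product], of x0 y z] nz by metis
    moreover have "scalar_product y (B *v \<phi> x) = 0" by (intro y rangeI)
    ultimately show False by (simp add: B scalar_product_scale_right)
  qed
  have "vec.span (\<Union>q\<in>?I. line_of q) = ?K"
  proof (intro equalityI)
    have "line_of q \<subseteq> ?K" if q: "q \<in> ?I" for q
    proof -
      obtain x where "q = point (\<phi> x)" "\<phi> x \<noteq> 0" "\<alpha> x = 0" using q unfolding image by blast
      then show ?thesis by (simp add: line_of_subset_subspace_iff[OF subK] B)
    qed
    then show "vec.span (\<Union>q\<in>?I. line_of q) \<subseteq> ?K"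
      by (intro vec.span_minimal subK) blast
    show "?K \<subseteq> vec.span (\<Union>q\<in>?I. line_of q)"
    proof (rule subsetI, rule ccontr)
      fix w assume w: "w \<in> ?K" "w \<notin> vec.span (\<Union>q\<in>?I. line_of q)"
      then obtain y where y: "\<And>s. s \<in> vec.span (\<Union>q\<in>?I. line_of q) \<Longrightarrow> scalar_product y s = 0"
        and yw: "scalar_product y w \<noteq> 0"
        using separating_functional[OF vec.subspace_span] by metis
      have "scalar_product y (\<phi> x) = 0" if "\<alpha> x = 0" for x
      proof (cases "\<phi> x = 0")
        case False
        then have "\<phi> x \<in> (\<Union>q\<in>?I. line_of q)"
          using that point_in_line unfolding image by blast
        then show ?thesis by (intro y vec.span_base)
      qed simp
      then obtain c where c: "\<And>x. scalar_product y (\<phi> x) = \<alpha> x * scalar_product c x"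
        using multiple by blast
      have "scalar_product (y + (- 1) *s (c v* B)) (\<phi> x) = 0" for x
      proof -
        have "scalar_product (c v* B) (\<phi> x) = \<alpha> x * scalar_product c x"
          by (simp add: B scalar_product_scale_right flip: scalar_product_matrix)
        then show ?thesis unfolding scalar_product_add_left scalar_product_scale_left by (simp add: c)
      qed
      then have "y + (- 1) *s (c v* B) = 0" by (rule indep)
      then have "y = c v* B" by (simp add: vec_eq_iff)
      then have "scalar_product y w = scalar_product c (B *v w)"
        by (simp add: scalar_product_matrix)
      then show False using yw w(1) by simp
    qed
  qed
  then have V: "V = {q. line_of q \<subseteq> ?K}" unfolding V_def proj_span_def by simp
  show "projection_from V B"
    unfolding projection_from_def V using surj by auto
  have lines: "(\<Union>q\<in>V. line_of q) = (if ?K = {0} then {} else ?K)"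
  proof (cases "?K = {0}")
    case True
    have "\<not> line_of q \<subseteq> ?K" for q
    proof -
      obtain v where "v \<noteq> 0" "q = point v" by (rule point_cases)
      then show ?thesis using True point_in_line by blast
    qed
    then show ?thesis using True V by auto
  next
    case False
    have "0 \<in> ?K" by simp
    then obtain v where v: "v \<in> ?K" "v \<noteq> 0" using False by blast
    have "w \<in> (\<Union>q\<in>V. line_of q)" if w: "w \<in> ?K" for w
    proof (cases "w = 0")
      case True
      have "point v \<in> V" "0 \<in> line_of (point v)"
        using v line_of_subset_subspace_iff[OF subK v(2)]
        by (auto simp: V line_of_point intro: range_eqI[of _ _ 0])
      then show ?thesis using True by blast
    next
      case nz: False
      then have "point w \<in> V" using w line_of_subset_subspace_iff[OF subK nz] by (simp add: V)
      then show ?thesis using point_in_line[OF nz] by blast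
    qed
    then show ?thesis using False V by auto
  qed
  have "vec.dim (\<Union>q\<in>V. line_of q) = vec.dim ?K"
    using vec.dim_eq_0[of "{}"] vec.dim_eq_0[of "{0}"] unfolding lines by auto
  then show "proj_dim V = int CARD('k) - int CARD('m) - 1"
    unfolding proj_dim_def using dim_kernel_of_surjection[OF surj] by linarith
qed

section \<open>Facets and vertices of a polytope with simple arrangement\<close>

text \<open>With \<open>t = 1\<close> this is a point of affine space in homogeneous coordinates, with \<open>t = 0\<close> a
  direction, or point at infinity.\<close>

definition affine_coords :: "real \<Rightarrow> real^'n::finite \<Rightarrow> complex^('n option)"
  where "affine_coords t x = (\<chi> j. case j of None \<Rightarrow> of_real t | Some i \<Rightarrow> of_real (x $ i))"

text \<open>The homogenization of the affine function with value \<open>a \<bullet> x - b\<close> at \<open>x\<close>.\<close>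

definition affine_form :: "real^'n::finite \<Rightarrow> real \<Rightarrow> complex^('n option) \<Rightarrow> complex"
  where "affine_form a b y = (\<Sum>i\<in>UNIV. of_real (a $ i) * y $ Some i) - of_real b * y $ None"

lemma affine_form_coords: "affine_form a b (affine_coords t x) = of_real (a \<bullet> x - b * t)"
  by (simp add: affine_form_def affine_coords_def inner_vec_def)

lemma affine_form_add: "affine_form a b (x + y) = affine_form a b x + affine_form a b y"
  by (simp add: affine_form_def sum.distrib algebra_simps)

lemma affine_form_scale: "affine_form a b (c *s x) = c * affine_form a b x"
  by (simp add: affine_form_def sum_distrib_left algebra_simps)

lemma affine_coords_diff:
  "affine_coords t x - affine_coords s y = affine_coords (t - s) (x - y)"
  by (auto simp: affine_coords_def vec_eq_iff split: option.split)

lemma chart_eq: "chart M x = point (M *v affine_coords 1 x)"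
proof -
  have "affine_coords 1 x = (\<chi> j. case j of None \<Rightarrow> 1 | Some i \<Rightarrow> complex_of_real (x $ i))"
    by (simp add: affine_coords_def del: of_real_eq_1_iff cong: option.case_cong)
  then show ?thesis unfolding chart_def by simp
qed

locale simple_projective_polytope =
  fixes P :: "(real^'n::finite) set"
    and M :: "complex^('n option)^('n option)"
    and l :: "(real^'n) set \<Rightarrow> complex^('n option) \<Rightarrow> complex"
  assumes polytope: "polytope P"
    and full_dim: "aff_dim P = int CARD('n)"
    and inv_M: "invertible M"
    and simple: "simple_arrangement (arrangement M P)"
    and equations: "facet_equations M P l"
begin

abbreviation lift :: "real^'n \<Rightarrow> complex^('n option)"
  where "lift x \<equiv> M *v affine_coords 1 x"

definition facets_at :: "real^'n \<Rightarrow> (real^'n) set set"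
  where "facets_at v = {F \<in> facets P. v \<in> F}"

lemma finite_facets: "finite (facets P)"
  using finite_polytope_facets[OF polytope] by (simp add: facets_def)

lemma M_eq_0_iff: "M *v y = 0 \<longleftrightarrow> y = 0"
proof -
  obtain N where "N ** M = mat 1" using inv_M unfolding invertible_def by blast
  then have "N *v (M *v y) = y" by (simp add: matrix_vector_mul_assoc)
  then show ?thesis by (metis matrix_vector_mult_0_right)
qed

lemma lift_nonzero: "lift x \<noteq> 0"
proof -
  have "affine_coords 1 x $ None = 1" by (simp add: affine_coords_def)
  then show ?thesis unfolding M_eq_0_iff by (metis zero_index zero_neq_one)
qed

lemma homogeneous_l: "F \<in> facets P \<Longrightarrow> homogeneous 1 (l F)"
  using equations by (simp add: facet_equations_def)

lemma l_scalar_product: "F \<in> facets P \<Longrightarrow> \<exists>c. l F = scalar_product c"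
  using homogeneous_one_imp_scalar_product[OF homogeneous_l] by metis

lemma l_add: "F \<in> facets P \<Longrightarrow> l F (x + y) = l F x + l F y"
  using l_scalar_product by (fastforce simp: scalar_product_add_right)

lemma l_scale: "F \<in> facets P \<Longrightarrow> l F (c *s x) = c * l F x"
  using l_scalar_product by (fastforce simp: scalar_product_scale_right)

lemma l_diff: "F \<in> facets P \<Longrightarrow> l F (x - y) = l F x - l F y"
  using l_add[of F "x - y" y] by simp

lemma point_in_hyperplane_iff:
  "F \<in> facets P \<Longrightarrow> y \<noteq> 0 \<Longrightarrow> point y \<in> facet_hyperplane M F \<longleftrightarrow> l F y = 0"
  using equations mem_zeros_point[OF homogeneous_l] unfolding facet_equations_def by metis

text \<open>The Zariski closure in the definition of a facet hyperplane adds nothing to the linear span of the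
  real points of the facet.\<close>

lemma l_eq_0_iff_span:
  assumes F: "F \<in> facets P"
  shows "l F y = 0 \<longleftrightarrow> y \<in> vec.span (lift ` F)"
proof (cases "y = 0")
  case True
  then show ?thesis using l_scale[OF F, of 0 0] by (simp add: vec.span_zero)
next
  case False
  have "chart M ` F = point ` lift ` F" by (simp add: image_image chart_eq)
  then have "facet_hyperplane M F = {p. line_of p \<subseteq> vec.span (lift ` F)}"
    unfolding facet_hyperplane_def proj_face_def
    using lift_nonzero by (subst \<open>chart M ` F = point ` lift ` F\<close>, intro proj_span_closure_points) auto
  then show ?thesis
    using point_in_hyperplane_iff[OF F False] line_of_subset_subspace_iff[OF vec.subspace_span False]
    by simp
qed

lemma affine_form_eq_0_if_l_eq_0:
  assumes F: "F \<in> facets P" and ab: "F \<subseteq> {x. a \<bullet> x = b}" and 0: "l F (M *v y) = 0"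
  shows "affine_form a b y = 0"
proof -
  obtain N where N: "N ** M = mat 1" using inv_M unfolding invertible_def by blast
  have NM: "N *v (M *v z) = z" for z by (simp add: matrix_vector_mul_assoc N)
  have "M *v y \<in> vec.span (lift ` F)" using l_eq_0_iff_span[OF F] 0 by simp
  also have "\<dots> \<subseteq> {z. affine_form a b (N *v z) = 0}"
  proof (rule vec.span_minimal)
    show "lift ` F \<subseteq> {z. affine_form a b (N *v z) = 0}"
      using ab by (auto simp: NM affine_form_coords)
    have "affine_form a b 0 = 0" by (simp add: affine_form_def)
    then show "vec.subspace {z. affine_form a b (N *v z) = 0}"
      by (auto simp: vec.subspace_def matrix_vector_right_distrib vector_scalar_commute
          affine_form_add affine_form_scale)
  qed
  finally show ?thesis by (simp add: NM)
qed

text \<open>A real supporting functional of the facet vanishes on the span of the facet, which is the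
  kernel of \<open>l F\<close>.  Since both forms are nonzero, they are proportional.  Hence questions about
  the complex hyperplanes reduce to real inequalities.\<close>

lemma facet_form:
  assumes F: "F \<in> facets P"
  obtains \<kappa> a b where "\<kappa> \<noteq> 0" and "\<And>y. l F (M *v y) = \<kappa> * affine_form a b y"
    and "P \<subseteq> {x. a \<bullet> x \<le> b}" and "F = P \<inter> {x. a \<bullet> x = b}"
proof -
  have facet: "F facet_of P" using F by (simp add: facets_def)
  obtain a b where ab: "P \<subseteq> {x. a \<bullet> x \<le> b}" "F = P \<inter> {x. a \<bullet> x = b}"
    using facet_of_polyhedron[OF polytope_imp_polyhedron[OF polytope] facet] by metis
  have "F \<noteq> P" "F \<subseteq> P" using facet facet_of_imp_subset facet_of_irrefl by blast+
  then obtain x where x: "x \<in> P" "x \<notin> F" by blast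
  then have s: "affine_form a b (affine_coords 1 x) \<noteq> 0" using ab by (simp add: affine_form_coords)
  have ker: "affine_form a b y = 0" if "l F (M *v y) = 0" for y
    using ab(2) that by (intro affine_form_eq_0_if_l_eq_0[OF F]) auto
  have t: "l F (lift x) \<noteq> 0" using s ker by metis
  let ?s = "affine_form a b (affine_coords 1 x)"
  have form: "l F (M *v y) = l F (lift x) / ?s * affine_form a b y" for y
  proof -
    define r where "r = l F (M *v y) / l F (lift x)"
    have "l F (M *v (y + (- r) *s affine_coords 1 x)) = 0"
      unfolding matrix_vector_right_distrib vector_scalar_commute l_add[OF F] l_scale[OF F]
      using t by (simp add: r_def)
    then have "affine_form a b (y + (- r) *s affine_coords 1 x) = 0"
      by (rule ker)
    then have "affine_form a b y = r * ?s" unfolding affine_form_add affine_form_scale by simp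
    then show ?thesis using s t by (simp add: r_def)
  qed
  show thesis
  proof (rule that)
    show "l F (lift x) / ?s \<noteq> 0" using s t by simp
  qed (rule form ab)+
qed

lemma l_lift_eq_0_iff:
  assumes "F \<in> facets P" and "x \<in> P"
  shows "l F (lift x) = 0 \<longleftrightarrow> x \<in> F"
proof -
  obtain \<kappa> a b where "\<kappa> \<noteq> 0" and "\<And>y. l F (M *v y) = \<kappa> * affine_form a b y"
    and "F = P \<inter> {x. a \<bullet> x = b}" using facet_form[OF assms(1)] by metis
  then show ?thesis using assms(2) by (simp add: affine_form_coords)
qed

lemma facets_at_eq: "x \<in> P \<Longrightarrow> facets_at x = {F \<in> facets P. l F (lift x) = 0}"
  using l_lift_eq_0_iff by (auto simp: facets_at_def)

lemma inj_on_facet_hyperplane: "inj_on (facet_hyperplane M) (facets P)"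
proof (rule inj_onI)
  fix F G assume FG: "F \<in> facets P" "G \<in> facets P" "facet_hyperplane M F = facet_hyperplane M G"
  have "F \<subseteq> P" "G \<subseteq> P" using FG by (auto simp: facets_def dest: facet_of_imp_subset)
  moreover have "x \<in> F \<longleftrightarrow> x \<in> G" if "x \<in> P" for x
    using FG l_lift_eq_0_iff[OF _ that] point_in_hyperplane_iff[OF _ lift_nonzero] by metis
  ultimately show "F = G" by blast
qed

text \<open>Simplicity of the arrangement counts hyperplanes; as distinct facets span distinct hyperplanes, it
  also bounds the number of facets.\<close>

lemma card_vanishing_facets:
  assumes "y \<noteq> 0" and "S \<subseteq> facets P" and "\<And>F. F \<in> S \<Longrightarrow> l F y = 0"
  shows "card S \<le> CARD('n)"
proof -
  have "facet_hyperplane M ` S \<subseteq> {H \<in> arrangement M P. point y \<in> H}"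
    using assms point_in_hyperplane_iff[OF _ assms(1)] by (auto simp: arrangement_def)
  moreover have "finite {H \<in> arrangement M P. point y \<in> H}"
    using finite_facets by (simp add: arrangement_def)
  ultimately have "card (facet_hyperplane M ` S) \<le> card {H \<in> arrangement M P. point y \<in> H}"
    by (intro card_mono)
  moreover have "card (facet_hyperplane M ` S) = card S"
    using inj_on_facet_hyperplane assms(2) by (metis card_image inj_on_subset)
  ultimately show ?thesis using simple unfolding simple_arrangement_def by (metis le_trans)
qed

lemma common_zero:
  assumes "S \<subseteq> facets P" and "card S = CARD('n)"
  obtains q where "q \<noteq> 0" and "\<And>F. F \<in> S \<Longrightarrow> l F q = 0"
proof -
  obtain c where c: "\<And>F. F \<in> facets P \<Longrightarrow> l F = scalar_product (c F)"
    using l_scalar_product by metis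
  have "finite S" "card S < CARD('n option)"
    using assms finite_facets finite_subset by (auto simp: card_option)
  then obtain q where "q \<noteq> 0" "\<And>F. F \<in> S \<Longrightarrow> scalar_product (c F) q = 0"
    using few_functionals_common_zero[of S c] by metis
  then show thesis using that c assms(1) by (metis subsetD)
qed

text \<open>Otherwise \<open>P\<close> would contain a segment through \<open>v\<close> in direction \<open>z\<close>: the inequalities that
  are strict at \<open>v\<close> remain so nearby, and the others stay equalities along \<open>z\<close>.\<close>

lemma direction_in_all_facets_at_vertex:
  assumes v: "v extreme_point_of P"
    and z: "\<And>F. F \<in> facets_at v \<Longrightarrow> l F (M *v affine_coords 0 z) = 0"
  shows "z = 0"
proof (rule ccontr)
  assume "z \<noteq> 0"
  have "v \<in> P" using v by (simp add: extreme_point_of_def)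
  obtain H where "finite H" and P: "P = affine hull P \<inter> \<Inter>H"
    and faces: "\<And>h. h \<in> H \<Longrightarrow> \<exists>a b. a \<noteq> 0 \<and> h = {x. a \<bullet> x \<le> b}"
    and min: "\<And>H'. H' \<subset> H \<Longrightarrow> P \<subset> affine hull P \<inter> \<Inter>H'"
    using polytope_imp_polyhedron[OF polytope] unfolding polyhedron_Int_affine_minimal by meson
  obtain a b where ab: "\<And>h. h \<in> H \<Longrightarrow> a h \<noteq> 0 \<and> h = {x. a h \<bullet> x \<le> b h}"
    using faces by metis
  note facet = facet_of_polyhedron_explicit[OF \<open>finite H\<close> P ab min]
  have "affine hull P = UNIV" using full_dim aff_dim_eq_full[of P] by simp
  then have P': "x \<in> P \<longleftrightarrow> (\<forall>h\<in>H. a h \<bullet> x \<le> b h)" for x using P ab by blast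
  \<comment> \<open>In a minimal system of inequalities each one defines a facet, so \<open>z\<close> is parallel to the bounding
    hyperplanes of all the half-spaces that are tight at \<open>v\<close>.\<close>
  have "\<forall>\<^sub>F t in nhds (0::real). a h \<bullet> (v + t *\<^sub>R z) \<le> b h" if h: "h \<in> H" for h
  proof (cases "a h \<bullet> v = b h")
    case True
    let ?F = "P \<inter> {x. a h \<bullet> x = b h}"
    have "?F \<in> facets P" using facet h by (auto simp: facets_def)
    moreover have "v \<in> ?F" using True \<open>v \<in> P\<close> by simp
    ultimately have "affine_form (a h) (b h) (affine_coords 0 z) = 0"
      using z by (intro affine_form_eq_0_if_l_eq_0[of ?F]) (auto simp: facets_at_def)
    then have "a h \<bullet> z = 0" by (simp add: affine_form_coords)
    then show ?thesis using True by (simp add: inner_add_right)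
  next
    case False
    then have "a h \<bullet> (v + 0 *\<^sub>R z) < b h" using h P' \<open>v \<in> P\<close> by force
    moreover have "((\<lambda>t. a h \<bullet> (v + t *\<^sub>R z)) \<longlongrightarrow> a h \<bullet> (v + 0 *\<^sub>R z)) (nhds 0)"
      by (intro tendsto_intros filterlim_ident)
    ultimately have "\<forall>\<^sub>F t in nhds (0::real). a h \<bullet> (v + t *\<^sub>R z) < b h"
      by (simp add: order_tendsto_iff)
    then show ?thesis by (rule eventually_mono) simp
  qed
  then have "\<forall>\<^sub>F t in nhds (0::real). v + t *\<^sub>R z \<in> P"
    unfolding P' using \<open>finite H\<close> by (simp add: eventually_ball_finite)
  then obtain e where "e > 0" and e: "\<And>t. dist t 0 < e \<Longrightarrow> v + t *\<^sub>R z \<in> P"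
    unfolding eventually_nhds_metric by blast
  have "v + (e / 2) *\<^sub>R z \<in> P" "v + (- e / 2) *\<^sub>R z \<in> P"
    using \<open>e > 0\<close> by (intro e; simp)+
  moreover have "midpoint (v + (e / 2) *\<^sub>R z) (v + (- e / 2) *\<^sub>R z) = v"
    by (simp add: midpoint_def vec_eq_iff)
  moreover have "v + (e / 2) *\<^sub>R z \<noteq> v + (- e / 2) *\<^sub>R z"
    using \<open>e > 0\<close> \<open>z \<noteq> 0\<close> by (simp add: vec_eq_iff)
  ultimately show False
    using v midpoint_in_open_segment unfolding extreme_point_of_def by metis
qed

lemma l_direction:
  assumes "F \<in> facets P"
  shows "l F (M *v affine_coords 0 (x - y)) = l F (lift x) - l F (lift y)"
proof -
  have "M *v affine_coords 0 (x - y) = lift x - lift y"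
    using affine_coords_diff[of 1 x 1 y] by (simp flip: matrix_vector_mult_diff_distrib)
  then show ?thesis using l_diff[OF assms] by simp
qed

text \<open>The difference of the two vertices is a direction that lies in all facets at \<open>v\<close>.\<close>

lemma vertex_unique:
  assumes v: "v extreme_point_of P" and w: "w extreme_point_of P" and sub: "facets_at v \<subseteq> facets_at w"
  shows "v = w"
proof -
  have vw: "v \<in> P" "w \<in> P" using v w by (simp_all add: extreme_point_of_def)
  have "l F (M *v affine_coords 0 (w - v)) = 0" if "F \<in> facets_at v" for F
  proof -
    have "F \<in> facets P" "v \<in> F" "w \<in> F" using that sub by (auto simp: facets_at_def)
    then show ?thesis
      using l_lift_eq_0_iff[OF _ vw(1), of F] l_lift_eq_0_iff[OF _ vw(2), of F]
      by (simp add: l_direction)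
  qed
  then have "w - v = 0" using direction_in_all_facets_at_vertex[OF v] by blast
  then show ?thesis by simp
qed

text \<open>With fewer than \<open>n\<close> facets at \<open>v\<close> there would be a complex direction in all of them; its real
  or its imaginary part is a nonzero real one.\<close>

lemma card_facets_at:
  assumes v: "v extreme_point_of P"
  shows "card (facets_at v) = CARD('n)"
proof (rule antisym)
  have "v \<in> P" using v by (simp add: extreme_point_of_def)
  show "card (facets_at v) \<le> CARD('n)"
    using card_vanishing_facets[OF lift_nonzero] facets_at_eq[OF \<open>v \<in> P\<close>] by auto
  show "CARD('n) \<le> card (facets_at v)"
  proof (rule ccontr)
    assume less: "\<not> CARD('n) \<le> card (facets_at v)"
    obtain c where c: "\<And>F. F \<in> facets P \<Longrightarrow> l F = scalar_product (c F)"
      using l_scalar_product by metis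
    have fin: "finite (facets_at v)" using finite_facets by (simp add: facets_at_def)
    \<comment> \<open>The functional at \<open>None\<close> makes the common zero a direction, or point at infinity.\<close>
    define S where "S = insert None (Some ` facets_at v)"
    define C where "C s = (case s of None \<Rightarrow> axis None 1 | Some F \<Rightarrow> c F v* M)" for s
    have "finite S" using fin by (simp add: S_def)
    moreover have "card S < CARD('n option)"
      using less fin by (simp add: S_def card_insert_disjoint image_iff card_image card_option)
    ultimately obtain y where y: "y \<noteq> 0" "\<And>s. s \<in> S \<Longrightarrow> scalar_product (C s) y = 0"
      using few_functionals_common_zero[of S C] by blast
    have y0: "y $ None = 0"
      using y(2)[of None] by (simp add: S_def C_def scalar_product_axis)
    have l0: "l F (M *v y) = 0" if "F \<in> facets_at v" for F
      using y(2)[of "Some F"] that c by (simp add: S_def C_def facets_at_def scalar_product_matrix)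
    define p q :: "real^'n" where "p = (\<chi> i. Re (y $ Some i))" and "q = (\<chi> i. Im (y $ Some i))"
    have "l F (M *v affine_coords 0 p) = 0 \<and> l F (M *v affine_coords 0 q) = 0" if F: "F \<in> facets_at v" for F
    proof -
      have "F \<in> facets P" using F by (simp add: facets_at_def)
      then obtain \<kappa> a b where \<kappa>: "\<kappa> \<noteq> 0" "\<And>y. l F (M *v y) = \<kappa> * affine_form a b y"
        using facet_form by metis
      then have "affine_form a b y = 0" using l0[OF F] by simp
      then have "(\<Sum>i\<in>UNIV. of_real (a $ i) * y $ Some i) = 0" by (simp add: affine_form_def y0)
      then have "Re (\<Sum>i\<in>UNIV. of_real (a $ i) * y $ Some i) = 0"
        "Im (\<Sum>i\<in>UNIV. of_real (a $ i) * y $ Some i) = 0" by simp_all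
      then have "a \<bullet> p = 0" "a \<bullet> q = 0" by (simp_all add: inner_vec_def p_def q_def)
      then show ?thesis by (simp add: \<kappa>(2) affine_form_coords)
    qed
    then have "p = 0" "q = 0" using direction_in_all_facets_at_vertex[OF v] by blast+
    then have "y $ Some i = 0" for i by (simp add: p_def q_def vec_eq_iff complex_eq_iff)
    then have "y $ j = 0" for j using y0 by (cases j) auto
    then show False using y(1) by (simp add: vec_eq_iff)
  qed
qed

text \<open>With at most \<open>n\<close> facets, every vertex would lie on all of them, so there would be a single
  vertex.\<close>

lemma card_facets: "CARD('n) < card (facets P)"
proof (rule ccontr)
  assume few: "\<not> CARD('n) < card (facets P)"
  let ?E = "{x. x extreme_point_of P}"
  have all: "facets_at v = facets P" if "v \<in> ?E" for v
    using few card_facets_at[of v] that finite_facets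
    by (intro card_seteq) (auto simp: facets_at_def)
  have P: "P = convex hull ?E"
    using Krein_Milman_Minkowski polytope_imp_compact polytope_imp_convex polytope by blast
  have "x = y" if "x \<in> ?E" "y \<in> ?E" for x y using vertex_unique[of x y] all that by auto
  then consider "?E = {}" | v where "?E = {v}" by blast
  then have "aff_dim P \<le> 0" using P by cases auto
  then show False using full_dim zero_less_card_finite[where 'a = 'n] by linarith
qed

text \<open>Relative to the remaining facet \<open>F\<close> at \<open>v\<close>, the directions to \<open>w\<close> and \<open>w'\<close> both point inwards, so a
  combination with positive ratio lies in all facets at \<open>v\<close> and is zero.  Thus \<open>w\<close> and
  \<open>w'\<close> are on the same ray from \<open>v\<close>, and unless they agree, one of them is between \<open>v\<close> and the
  other, which is impossible for an extreme point.\<close>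

lemma at_most_two_vertices_on_line:
  assumes v: "v extreme_point_of P" and w: "w extreme_point_of P" and w': "w' extreme_point_of P"
    and S: "facets_at v = insert F S" "S \<subseteq> facets_at w" "S \<subseteq> facets_at w'"
    and ne: "w \<noteq> v" "w' \<noteq> v"
  shows "w = w'"
proof (rule ccontr)
  assume "w \<noteq> w'"
  have P: "v \<in> P" "w \<in> P" "w' \<in> P" using v w w' by (simp_all add: extreme_point_of_def)
  have F: "F \<in> facets P" "v \<in> F" using S(1) by (auto simp: facets_at_def)
  obtain \<kappa> a b where \<kappa>: "\<kappa> \<noteq> 0" "\<And>y. l F (M *v y) = \<kappa> * affine_form a b y"
    and ab: "P \<subseteq> {x. a \<bullet> x \<le> b}" "F = P \<inter> {x. a \<bullet> x = b}" using facet_form[OF F(1)] by metis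
  have "w \<notin> F" "w' \<notin> F"
    using S F(1) vertex_unique[OF v w] vertex_unique[OF v w'] ne by (auto simp: facets_at_def)
  then have lt: "a \<bullet> w < b" "a \<bullet> w' < b" using ab P by (auto simp: less_le)
  define r where "r = (b - a \<bullet> w) / (b - a \<bullet> w')"
  have "r > 0" using lt by (simp add: r_def)
  have "l G (M *v affine_coords 0 ((w - v) - r *\<^sub>R (w' - v))) = 0" if G: "G \<in> facets_at v" for G
  proof -
    have GP: "G \<in> facets P" "v \<in> G" using G by (auto simp: facets_at_def)
    have "affine_coords 0 ((w - v) - r *\<^sub>R (w' - v)) =
        affine_coords 0 (w - v) + (- of_real r) *s affine_coords 0 (w' - v)"
      by (auto simp: affine_coords_def vec_eq_iff split: option.split)
    then have "l G (M *v affine_coords 0 ((w - v) - r *\<^sub>R (w' - v))) =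
        l G (lift w) - l G (lift v) - of_real r * (l G (lift w') - l G (lift v))"
      by (simp only: matrix_vector_right_distrib vector_scalar_commute l_add[OF GP(1)]
          l_scale[OF GP(1)] l_direction[OF GP(1)]) simp
    also have "\<dots> = l G (lift w) - of_real r * l G (lift w')"
      using l_lift_eq_0_iff[OF GP(1) P(1)] GP(2) by simp
    also have "\<dots> = 0"
    proof (cases "G = F")
      case True
      have "(a \<bullet> w - b) - r * (a \<bullet> w' - b) = 0" using lt by (simp add: r_def field_simps)
      then have "a \<bullet> w - b = r * (a \<bullet> w' - b)" by simp
      then have "complex_of_real (a \<bullet> w - b) = of_real r * of_real (a \<bullet> w' - b)"
        by (simp only: flip: of_real_mult)
      then show ?thesis unfolding True \<kappa>(2) affine_form_coords by simp
    next
      case False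
      then have "G \<in> facets_at w" "G \<in> facets_at w'" using G S by blast+
      then have "w \<in> G" "w' \<in> G" by (simp_all add: facets_at_def)
      then have "l G (lift w) = 0" "l G (lift w') = 0"
        using l_lift_eq_0_iff[OF GP(1) P(2)] l_lift_eq_0_iff[OF GP(1) P(3)] by simp_all
      then show ?thesis by simp
    qed
    finally show ?thesis .
  qed
  then have "(w - v) - r *\<^sub>R (w' - v) = 0" by (rule direction_in_all_facets_at_vertex[OF v])
  then have eq: "w - v = r *\<^sub>R (w' - v)" by simp
  then have "r \<noteq> 1" using \<open>w \<noteq> w'\<close> by auto
  show False
  proof (cases "r < 1")
    case True
    have "w = (1 - r) *\<^sub>R v + r *\<^sub>R w'" using eq by (simp add: algebra_simps)
    then have "w \<in> open_segment v w'" using True \<open>r > 0\<close> ne by (auto simp: in_segment)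
    then show False using w P by (auto simp: extreme_point_of_def)
  next
    case False
    have "w' - v = (1 / r) *\<^sub>R (w - v)" using eq \<open>r > 0\<close> by simp
    then have "w' = (1 - 1 / r) *\<^sub>R v + (1 / r) *\<^sub>R w" by (simp add: algebra_simps)
    then have "w' \<in> open_segment v w" using False \<open>r \<noteq> 1\<close> \<open>r > 0\<close> ne
      by (auto simp: in_segment intro!: exI[of _ "1 / r"])
    then show False using w' P by (auto simp: extreme_point_of_def)
  qed
qed

text \<open>The intersection of the hyperplanes of \<open>S\<close> is part of the residual arrangement: if it contained a
  face of \<open>P\<close>, it would contain a vertex of that face, and \<open>S\<close> would be the set of facets at
  this vertex.\<close>

lemma adjoint_vanishes_off_vertices:
  assumes adj: "adjoint_equation M P \<alpha>" and S: "S \<subseteq> facets P" "card S = CARD('n)"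
    and not_vertex: "\<And>v. v extreme_point_of P \<Longrightarrow> facets_at v \<noteq> S"
    and q: "q \<noteq> 0" "\<And>F. F \<in> S \<Longrightarrow> l F q = 0"
  shows "\<alpha> q = 0"
proof -
  let ?L = "\<Inter>(facet_hyperplane M ` S)"
  have "\<not> G \<subseteq> ?L" if G_face: "G \<in> proj_polytope M P" for G
  proof
    assume G: "G \<subseteq> ?L"
    obtain E where E: "E face_of P" "E \<noteq> {}" "G = proj_face M E"
      using G_face by (auto simp: proj_polytope_def)
    then have "compact E" "convex E"
      using polytope by (auto intro: face_of_imp_compact face_of_imp_convex
          polytope_imp_compact polytope_imp_convex)
    then obtain v where v: "v extreme_point_of E" using extreme_point_exists_convex E(2) by blast
    then have vP: "v extreme_point_of P" "v \<in> E" using extreme_point_of_face[OF E(1)] by auto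
    then have "chart M v \<in> G"
      unfolding E(3) proj_face_def by (intro subsetD[OF subset_zariski_closure] imageI)
    then have "point (lift v) \<in> ?L" using G by (auto simp: chart_eq)
    then have "S \<subseteq> facets_at v"
      using point_in_hyperplane_iff[OF _ lift_nonzero] S(1) vP(1) facets_at_eq[of v]
      by (auto simp: extreme_point_of_def)
    moreover have "finite (facets_at v)" using finite_facets by (simp add: facets_at_def)
    ultimately have "S = facets_at v"
      using S(2) card_facets_at[OF vP(1)] by (intro card_subset_eq) auto
    then show False using not_vertex vP(1) by blast
  qed
  moreover have "facet_hyperplane M ` S \<subseteq> arrangement M P"
    using S(1) by (auto simp: arrangement_def)
  ultimately have "?L \<in> {L. (\<exists>\<C>. \<C> \<subseteq> arrangement M P \<and> L = \<Inter>\<C>) \<and>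
      (\<forall>G\<in>proj_polytope M P. \<not> G \<subseteq> L)}" by (intro CollectI conjI exI ballI) simp_all
  then have "?L \<subseteq> residual_arrangement M P"
    unfolding residual_arrangement_def by (rule Union_upper)
  moreover have "point q \<in> ?L"
    using q(2) S(1) point_in_hyperplane_iff[OF _ q(1)] by (intro INT_I) auto
  ultimately have "point q \<in> zeros \<alpha>" using adj by (auto simp: adjoint_equation_def)
  then show ?thesis using adj mem_zeros_point[OF _ q(1)] by (auto simp: adjoint_equation_def)
qed

end

section \<open>The Wachspress map and the adjoint\<close>

locale polytope_adjoint = simple_projective_polytope P M l
  for P :: "(real^'n::finite) set"
    and M :: "complex^('n option)^('n option)"
    and l :: "(real^'n) set \<Rightarrow> complex^('n option) \<Rightarrow> complex" +
  fixes u :: "'v::finite \<Rightarrow> real^'n"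
    and \<alpha> :: "complex^('n option) \<Rightarrow> complex"
  assumes enumeration: "vertex_enumeration P u"
    and adjoint: "adjoint_equation M P \<alpha>"
begin

definition adjoint_degree :: nat
  where "adjoint_degree = card (facets P) - CARD('n) - 1"

definition wachspress :: "complex^('n option) \<Rightarrow> complex^'v"
  where "wachspress x = (\<chi> j. \<Prod>F | F \<in> facets P \<and> u j \<notin> F. l F x)"

definition facet_product :: "(real^'n) set set \<Rightarrow> complex^('n option) \<Rightarrow> complex"
  where "facet_product S x = (\<Prod>F\<in>facets P - S. l F x)"

lemma card_facets_eq: "card (facets P) = CARD('n) + Suc adjoint_degree"
  using card_facets by (simp add: adjoint_degree_def)

lemma homogeneous_adjoint: "homogeneous adjoint_degree \<alpha>"
  using adjoint by (simp add: adjoint_equation_def adjoint_degree_def)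

lemma vertex: "u j extreme_point_of P"
  using enumeration by (auto simp: vertex_enumeration_def bij_betw_def)

lemma vertex_in_range: "v extreme_point_of P \<Longrightarrow> \<exists>j. v = u j"
  using enumeration by (auto simp: vertex_enumeration_def bij_betw_def)

lemma facets_at_u_eq_iff: "facets_at (u j) = facets_at (u k) \<longleftrightarrow> j = k"
proof
  assume "facets_at (u j) = facets_at (u k)"
  then have "u j = u k" using vertex_unique[OF vertex vertex] by blast
  then show "j = k" using enumeration by (auto simp: vertex_enumeration_def bij_betw_def inj_def)
qed simp

lemma wachspress_eq: "wachspress x $ j = facet_product (facets_at (u j)) x"
  unfolding wachspress_def facet_product_def by (auto simp: facets_at_def intro!: prod.cong)

lemma homogeneous_wachspress: "homogeneous (Suc adjoint_degree) (\<lambda>x. wachspress x $ j)"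
proof -
  have "card (facets P - facets_at (u j)) = Suc adjoint_degree"
    using card_facets_at[OF vertex] card_facets_eq finite_facets
    by (subst card_Diff_subset) (auto simp: facets_at_def)
  then show ?thesis
    using homogeneous_prod_linear[of "facets P - facets_at (u j)" l] homogeneous_l
    unfolding wachspress_eq facet_product_def by auto
qed

text \<open>At a common zero of \<open>n\<close> of the facet forms no other one vanishes, so the products are dual to
  these points.\<close>

lemma facet_product_at_common_zero:
  assumes S: "S \<subseteq> facets P" "card S = CARD('n)" and R: "R \<subseteq> facets P" "card R = CARD('n)"
    and q: "q \<noteq> 0" "\<And>F. F \<in> S \<Longrightarrow> l F q = 0"
  shows "facet_product R q = 0 \<longleftrightarrow> R \<noteq> S"
proof
  assume "facet_product R q = 0"
  then obtain F where F: "F \<in> facets P - R" "l F q = 0"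
    using finite_facets by (auto simp: facet_product_def)
  have "F \<in> S"
  proof (rule ccontr)
    assume "F \<notin> S"
    then have "card (insert F S) = Suc CARD('n)"
      using S finite_subset[OF S(1) finite_facets] by simp
    moreover have "card (insert F S) \<le> CARD('n)"
      using F q S by (intro card_vanishing_facets[OF q(1)]) auto
    ultimately show False by simp
  qed
  then show "R \<noteq> S" using F by auto
next
  assume "R \<noteq> S"
  then have "\<not> S \<subseteq> R"
    using card_subset_eq[of R S] S R finite_subset[OF R(1) finite_facets] by auto
  then obtain F where "F \<in> S" "F \<notin> R" by blast
  then show "facet_product R q = 0"
    using S q(2) finite_facets by (auto simp: facet_product_def)
qed

lemma lift_vertex_common_zero:
  assumes "v extreme_point_of P" and "F \<in> facets_at v"
  shows "l F (lift v) = 0"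
  using assms facets_at_eq[of v] by (auto simp: extreme_point_of_def)

lemma facets_at_subset: "facets_at v \<subseteq> facets P"
  by (auto simp: facets_at_def)

lemma wachspress_at_vertex: "wachspress (lift (u k)) $ j = 0 \<longleftrightarrow> j \<noteq> k"
proof -
  have "facet_product (facets_at (u j)) (lift (u k)) = 0 \<longleftrightarrow> facets_at (u j) \<noteq> facets_at (u k)"
    by (rule facet_product_at_common_zero[OF facets_at_subset card_facets_at[OF vertex]
          facets_at_subset card_facets_at[OF vertex] lift_nonzero lift_vertex_common_zero[OF vertex]])
  then show ?thesis unfolding wachspress_eq by (simp add: facets_at_u_eq_iff)
qed

text \<open>The matrix of the values of the coordinates of the map at the vertices is diagonal with nonzero
  entries.\<close>

lemma wachspress_independent:
  assumes "\<And>x. scalar_product y (wachspress x) = 0"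
  shows "y = 0"
proof -
  have "y $ j = 0" for j
  proof -
    have "scalar_product y (wachspress (lift (u j))) =
        (\<Sum>k\<in>{j}. y $ k * wachspress (lift (u j)) $ k)"
      unfolding scalar_product_def using wachspress_at_vertex by (intro sum.mono_neutral_right) auto
    then show ?thesis using assms wachspress_at_vertex[of j j] by simp
  qed
  then show ?thesis by (simp add: vec_eq_iff)
qed

text \<open>Expand the product in the basis of facet products.  Evaluation at the dual points determines the
  coefficients: they are zero off the vertices, where the adjoint vanishes, and also at each
  vertex where the adjoint vanishes.\<close>

lemma adjoint_times_coordinate:
  "\<exists>b. (\<forall>x. \<alpha> x * x $ i = (\<Sum>j\<in>UNIV. b j * wachspress x $ j)) \<and>
    (\<forall>j. \<alpha> (lift (u j)) = 0 \<longrightarrow> b j = 0)"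
proof -
  let ?I = "{S. S \<subseteq> facets P \<and> card S = CARD('n)}"
  have fin: "finite ?I" using finite_facets by simp
  have "homogeneous (Suc adjoint_degree) (\<lambda>x. \<alpha> x * x $ i)"
    using homogeneous_mult[OF homogeneous_adjoint homogeneous_coordinate] by simp
  moreover have "\<forall>S y. S \<subseteq> facets P \<longrightarrow> card S = CARD('n option) \<longrightarrow> (\<forall>F\<in>S. l F y = 0) \<longrightarrow> y = 0"
    using card_vanishing_facets by (auto simp: card_option) (metis not_less_eq_eq le_refl)
  moreover have "card (facets P) + 1 = CARD('n option) + Suc adjoint_degree"
    using card_facets_eq by (simp add: card_option)
  ultimately obtain c where c: "\<And>x. \<alpha> x * x $ i = (\<Sum>S\<in>?I. c S * facet_product S x)"
    using forms_spanned_by_products[of "Suc adjoint_degree" "\<lambda>x. \<alpha> x * x $ i" "facets P" l] finite_facets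
      homogeneous_l unfolding facet_product_def by (auto simp: card_option)
  have coeff: "\<alpha> q * q $ i = c S * facet_product S q" "facet_product S q \<noteq> 0"
    if S: "S \<in> ?I" and q: "q \<noteq> 0" "\<And>F. F \<in> S \<Longrightarrow> l F q = 0" for S q
  proof -
    have zero_iff: "facet_product R q = 0 \<longleftrightarrow> R \<noteq> S" if "R \<in> ?I" for R
      using facet_product_at_common_zero[of S R q] S that q by blast
    then show "facet_product S q \<noteq> 0" using S by blast
    have "(\<Sum>R\<in>?I. c R * facet_product R q) = (\<Sum>R\<in>{S}. c R * facet_product R q)"
      using S zero_iff by (intro sum.mono_neutral_right[OF fin]) simp_all
    then show "\<alpha> q * q $ i = c S * facet_product S q" using c by simp
  qed
  have off: "c S = 0" if S: "S \<in> ?I" "S \<notin> (\<lambda>j. facets_at (u j)) ` UNIV" for S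
  proof -
    obtain q where q: "q \<noteq> 0" "\<And>F. F \<in> S \<Longrightarrow> l F q = 0" using common_zero S(1) by blast
    have "facets_at v \<noteq> S" if "v extreme_point_of P" for v
      using vertex_in_range[OF that] S(2) by blast
    then have "\<alpha> q = 0"
      using S(1) by (intro adjoint_vanishes_off_vertices[OF adjoint _ _ _ q]) auto
    then show ?thesis using coeff[OF S(1) q] by simp
  qed
  have I: "facets_at (u j) \<in> ?I" for j using card_facets_at[OF vertex] facets_at_subset by blast
  have "\<alpha> x * x $ i = (\<Sum>j\<in>UNIV. c (facets_at (u j)) * wachspress x $ j)" for x
  proof -
    have "\<alpha> x * x $ i = (\<Sum>S\<in>(\<lambda>j. facets_at (u j)) ` UNIV. c S * facet_product S x)"
      unfolding c using I off fin by (intro sum.mono_neutral_right) auto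
    then show ?thesis
      by (subst (asm) sum.reindex) (auto simp: inj_def facets_at_u_eq_iff wachspress_eq)
  qed
  moreover have "c (facets_at (u j)) = 0" if "\<alpha> (lift (u j)) = 0" for j
    using coeff[OF I lift_nonzero lift_vertex_common_zero[OF vertex, of _ j]] that by simp
  ultimately show ?thesis by (intro exI[of _ "\<lambda>j. c (facets_at (u j))"]) blast
qed

text \<open>A form that is nonzero at the origin is a constant.\<close>

lemma adjoint_nonzero: "\<exists>x. x \<noteq> 0 \<and> \<alpha> x \<noteq> 0"
proof -
  obtain x where x: "\<alpha> x \<noteq> 0" using adjoint by (auto simp: adjoint_equation_def)
  show ?thesis
  proof (cases "x = 0")
    case True
    then have "adjoint_degree = 0" using x homogeneous_scale[OF homogeneous_adjoint, of 0 0] by (cases adjoint_degree) auto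
    then have "\<alpha> (lift (u undefined)) \<noteq> 0"
      using homogeneous_scale[OF homogeneous_adjoint, of 0 "lift (u undefined)"] x True by simp
    then show ?thesis using lift_nonzero by blast
  qed (use x in blast)
qed

text \<open>Otherwise all products of \<open>\<alpha>\<close> with coordinates would be zero, by their expansions.\<close>

lemma adjoint_nonzero_at_some_vertex: "\<exists>j. \<alpha> (lift (u j)) \<noteq> 0"
proof (rule ccontr)
  assume "\<not> ?thesis"
  then have "\<alpha> x * x $ i = 0" for x i using adjoint_times_coordinate[of i] by auto
  then show False using adjoint_nonzero by (auto simp: vec_eq_iff)
qed

text \<open>The line is the intersection of \<open>n - 1\<close> of the facet hyperplanes through \<open>v\<close>.  Each of the
  \<open>d - n\<close> facets away from \<open>v\<close> cuts it in a point, and these points are distinct because the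
  arrangement is simple.  At most one of them is a vertex of \<open>P\<close>, and the adjoint vanishes at the
  others.\<close>

lemma adjoint_distinct_zeros_on_line:
  assumes v: "v extreme_point_of P"
  obtains x0 T where "finite T" and "card T = adjoint_degree" and "\<And>t. t \<in> T \<Longrightarrow> \<alpha> (x0 + t *s lift v) = 0"
proof -
  have "v \<in> P" using v by (simp add: extreme_point_of_def)
  have fin: "finite (facets_at v)" using finite_facets facets_at_subset finite_subset by blast
  have "facets_at v \<noteq> {}" using card_facets_at[OF v] by auto
  then obtain F0 where F0: "F0 \<in> facets_at v" by blast
  define S where "S = facets_at v - {F0}"
  have S: "facets_at v = insert F0 S" "F0 \<notin> S" "finite S" "S \<subseteq> facets P" "F0 \<in> facets P"
    using F0 fin facets_at_subset by (auto simp: S_def)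
  have "Suc (card S) = CARD('n)" using card_facets_at[OF v] S by simp
  define E where "E = facets P - facets_at v"
  have cardE: "card E = Suc adjoint_degree"
    using card_facets_at[OF v] card_facets_eq finite_facets facets_at_subset fin
    by (simp add: E_def card_Diff_subset)
  have finE: "finite E" using finite_facets by (simp add: E_def)
  have E: "E \<subseteq> facets P" "\<And>F. F \<in> E \<Longrightarrow> F \<notin> S \<and> F \<noteq> F0"
    using S by (auto simp: E_def)
  have SF: "insert F S \<subseteq> facets P" "card (insert F S) = CARD('n)" if "F \<in> E" for F
    using that E S \<open>Suc (card S) = CARD('n)\<close> by auto
  \<comment> \<open>Simplicity: no further facet hyperplane passes through a point of the line on that of \<open>F\<close>.\<close>
  have two: False if "F \<in> E" "G \<in> facets P" "G \<notin> insert F S" "y \<noteq> 0"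
    and "\<And>H. H \<in> insert G (insert F S) \<Longrightarrow> l H y = 0" for F G y
  proof -
    have "card (insert G (insert F S)) = Suc CARD('n)"
      using that(3) SF[OF that(1)] S(3) by simp
    moreover have "card (insert G (insert F S)) \<le> CARD('n)"
      using that SF[OF that(1)] by (intro card_vanishing_facets[OF \<open>y \<noteq> 0\<close>]) auto
    ultimately show False by simp
  qed
  \<comment> \<open>A second point of the line, different from \<open>v\<close>: its intersection with the hyperplane of any
    facet away from \<open>v\<close>.\<close>
  obtain F1 where F1: "F1 \<in> E" using cardE by (metis card.empty ex_in_conv nat.distinct(1))
  obtain x0 where x0: "x0 \<noteq> 0" "\<And>F. F \<in> insert F1 S \<Longrightarrow> l F x0 = 0"
    using common_zero[OF SF[OF F1]] by blast
  have lF0: "l F0 x0 \<noteq> 0"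
    using two[OF F1 S(5) _ x0(1)] x0(2) S(2) E(2)[OF F1] by auto
  have lv: "l F (lift v) \<noteq> 0" if "F \<in> E" for F
    using that l_lift_eq_0_iff[OF _ \<open>v \<in> P\<close>] by (auto simp: E_def facets_at_def)
  \<comment> \<open>The parameter of the point of the line on the hyperplane of \<open>F\<close>.\<close>
  define t where "t F = - l F x0 / l F (lift v)" for F
  define y where "y F = x0 + t F *s lift v" for F
  have ly: "l G (y F) = l G x0 + t F * l G (lift v)" if "G \<in> facets P" for F G
    using that by (simp add: y_def l_add l_scale)
  have lv0: "l G (lift v) = 0" if "G \<in> facets_at v" for G
    using lift_vertex_common_zero[OF v that] .
  have y0: "y F \<noteq> 0" for F
    using ly[OF S(5), of F] lv0[OF F0] lF0 l_scale[OF S(5), of 0 0] by auto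
  have yS: "l G (y F) = 0" if "F \<in> E" "G \<in> insert F S" for F G
  proof (cases "G = F")
    case True
    then show ?thesis using that ly[of G F] lv[of F] E by (auto simp: t_def)
  next
    case False
    then show ?thesis using that ly[of G F] lv0[of G] x0(2)[of G] S by auto
  qed
  have inj: "inj_on t E"
  proof (rule inj_onI, rule ccontr)
    fix F G assume FG: "F \<in> E" "G \<in> E" "t F = t G" "F \<noteq> G"
    then have "y F = y G" by (simp add: y_def)
    then show False
      using two[of F G "y F"] FG E yS[of F] yS[of G] y0 by auto
  qed
  define bad where "bad = {F \<in> E. \<exists>w. w extreme_point_of P \<and> facets_at w = insert F S}"
  have "F = G" if bad: "F \<in> bad" "G \<in> bad" for F G
  proof -
    obtain w w' where w: "w extreme_point_of P" "facets_at w = insert F S" "F \<in> E"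
      and w': "w' extreme_point_of P" "facets_at w' = insert G S" "G \<in> E"
      using bad unfolding bad_def by blast
    have "F \<in> facets_at w" "G \<in> facets_at w'" "F \<notin> facets_at v" "G \<notin> facets_at v"
      using w(2,3) w'(2,3) by (simp_all add: E_def)
    then have "w \<noteq> v" "w' \<noteq> v" by metis+
    then have "w = w'"
      using w(2) w'(2) by (intro at_most_two_vertices_on_line[OF v w(1) w'(1) S(1)]) auto
    then show "F = G" using w(2,3) w'(2,3) E(2) by blast
  qed
  then have "bad = {} \<or> (\<exists>F. bad = {F})" by blast
  then have "card bad \<le> 1" by auto
  have "bad \<subseteq> E" by (auto simp: bad_def)
  then have "card (E - bad) \<ge> adjoint_degree"
    using cardE \<open>card bad \<le> 1\<close> finE by (simp add: card_Diff_subset finite_subset)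
  then obtain G where G: "G \<subseteq> E - bad" "card G = adjoint_degree" "finite G"
    by (rule obtain_subset_with_card_n)
  show thesis
  proof (rule that[of "t ` G"])
    show "card (t ` G) = adjoint_degree" using G inj by (metis Diff_subset card_image inj_on_subset)
    fix s assume "s \<in> t ` G"
    then obtain F where F: "F \<in> E" "F \<notin> bad" "s = t F" using G by blast
    have "\<alpha> (y F) = 0"
    proof (rule adjoint_vanishes_off_vertices[OF adjoint SF[OF F(1)] _ y0])
      show "facets_at w \<noteq> insert F S" if "w extreme_point_of P" for w
        using that F by (auto simp: bad_def)
    qed (rule yS[OF F(1)])
    then show "\<alpha> (x0 + s *s lift v) = 0" using F(3) by (simp add: y_def)
  qed (use G in simp)
qed

lemma wachspress_form_vanishing_on_adjoint:
  assumes "\<And>x. \<alpha> x = 0 \<Longrightarrow> scalar_product y (wachspress x) = 0"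
  shows "\<exists>c. \<forall>x. scalar_product y (wachspress x) = \<alpha> x * scalar_product c x"
proof -
  obtain j where j: "\<alpha> (lift (u j)) \<noteq> 0" using adjoint_nonzero_at_some_vertex by blast
  obtain x0 T where T: "finite T" "card T = adjoint_degree" "\<And>t. t \<in> T \<Longrightarrow> \<alpha> (x0 + t *s lift (u j)) = 0"
    using adjoint_distinct_zeros_on_line[OF vertex] by metis
  have hom: "homogeneous (Suc adjoint_degree) (\<lambda>x. scalar_product y (wachspress x))"
    unfolding scalar_product_def
    by (intro homogeneous_sum homogeneous_cmult homogeneous_wachspress)
  show ?thesis
    by (rule linear_multiple_if_vanishing_on_hypersurface[OF homogeneous_adjoint hom j T assms]) blast+
qed

end

theorem theorem1p12:
  fixes P :: "(real^'n::finite) set"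
    and M :: "complex^('n option)^('n option)"
    and u :: "'v::finite \<Rightarrow> real^'n"
    and l :: "(real^'n) set \<Rightarrow> complex^('n option) \<Rightarrow> complex"
    and \<alpha> :: "complex^('n option) \<Rightarrow> complex"
  assumes "polytope P" and "aff_dim P = int CARD('n)"
    and "invertible M"
    and "simple_arrangement (arrangement M P)"
    and "vertex_enumeration P u"
    and "facet_equations M P l"
    and "adjoint_equation M P \<alpha>"
  shows "proj_dim (adjoint_image_span P l u \<alpha>) = int CARD('v) - int CARD('n) - 2 \<and>
    (\<exists>B :: complex^'v^('n option).
      projection_from (adjoint_image_span P l u \<alpha>) B \<and>
      rational_inverse UNIV (wachspress_variety P l u)
        (wachspress_map P l u)
        (rational_map (\<lambda>w. B *v w) |` wachspress_variety P l u))"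
proof -
  interpret polytope_adjoint P M l u \<alpha>
    using assms by unfold_locales
  have map: "wachspress_map P l u = rational_map wachspress"
    unfolding wachspress_map_def wachspress_def[abs_def] ..
  obtain b where b: "\<And>i x. \<alpha> x * x $ i = (\<Sum>j\<in>UNIV. b i j * wachspress x $ j)"
    using adjoint_times_coordinate by metis
  define B :: "complex^'v^('n option)" where "B = (\<chi> i j. b i j)"
  have B: "B *v wachspress x = \<alpha> x *s x" for x
    by (simp add: B_def matrix_vector_mult_def vec_eq_iff b)
  obtain x0 where x0: "x0 \<noteq> 0" "\<alpha> x0 \<noteq> 0" using adjoint_nonzero by blast
  note inverse = rational_inverse_projection[OF homogeneous_wachspress homogeneous_adjoint
      x0(2,1) B]
  note projection = projection_from_hypersurface_image[OF homogeneous_wachspress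
      homogeneous_adjoint x0(2) B wachspress_independent wachspress_form_vanishing_on_adjoint]
  show ?thesis
    unfolding adjoint_image_span_def wachspress_variety_def map
  proof (intro conjI exI)
    show "proj_dim (proj_span (map_image (rational_map wachspress) (zeros \<alpha>))) =
        int CARD('v) - int CARD('n) - 2"
      using projection(2) by (simp add: card_option)
    show "projection_from (proj_span (map_image (rational_map wachspress) (zeros \<alpha>))) B"
      by (rule projection(1))
    show "rational_inverse UNIV (zariski closure_of map_image (rational_map wachspress) UNIV)
        (rational_map wachspress)
        (rational_map ((*v) B) |` (zariski closure_of map_image (rational_map wachspress) UNIV))"
      by (rule inverse)
  qed
qed

end
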